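(* Let the data, the simplicial mesh $\mathcal{T}$ of $\Omega$, the lifting $\phi^D_{\mathcal{T}}$ and the time sequence $(t^k)_{k=0,\dots,N_T}$ be as in the context. Then there exists at least one solution $((\mu_{i,K}^{k})_{i=1,\dots,n,\,K\in\mathcal{M}},(\phi_{K}^{k})_{K\in\mathcal{M}})_{k=1,\dots,N_T}$ (family of real numbers) to the CVFE scheme (S1)-(S6). This holds for each of the two possible choices (max) and (ave) in (S5).
   Context: **Data.** $d\in\{2,3\}$; $\Omega\subset\mathbb{R}^d$ is a bounded connected open polytopal set, with regular boundary $\partial\Omega=\Gamma_D\cup\Gamma_N$ regularly partitioned into $\Gamma_D,\Gamma_N$; $T>0$; $\lambda,\beta>0$; $n\ge 1$; $z_i\in\mathbb{R}$ and $D_i>0$ for $i=1,\dots,n$; $u_i^{\rm ini}\in L^\infty(\Omega)$, $i=0,\dots,n$, with $u_i^{\rm ini}\ge 0$, $\sum_{i=0}^n u_i^{\rm ini}=1$ a.e. and $M_i=\int_\Omega u_i^{\rm ini}\,dx>0$ for $i=0,\dots,n$; $\phi^D\in H^1(\Omega)$; $f\in L^2(\Omega)$. $H^1_D(\Omega)$ is the set of elements of $H^1(\Omega)$ with zero trace on $\Gamma_D$; it is assumed that there is $C_P>0$ with $\|v\|_{L^2(\Omega)}\le C_P\|\nabla v\|_{L^2(\Omega)}$ for all $v\in H^1_D(\Omega)$. **Mesh.** $\mathcal{T}$ is a finite collection of disjoint open simplices with $\bigcup_{S\in\mathcal{T}}\overline S=\overline\Omega$, conforming (no hanging nodes). Its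 vertices are $\{x_K, K\in\mathcal{M}\}$. $\mathcal{M}_S$ is the set of (indices of) vertices of $S$, $\mathcal{T}_K$ the set of simplices having $x_K$ as a vertex, $\mathcal{M}_D$ the set of (indices of) vertices located on $\Gamma_D$. $V_{\mathcal{T}}$ is the conforming $\mathbb{P}_1$ finite element space on $\mathcal{T}$ with nodal basis $(e_K)_{K\in\mathcal{M}}$; for $v\in V_{\mathcal{T}}$, $\nabla v(S)$ is the constant value of $\nabla v$ in $S$. $V_{\mathcal{T},D}=\{v\in V_{\mathcal{T}}: v(x_K)=0\ \forall K\in\mathcal{M}_D\}$, assumed to satisfy $V_{\mathcal{T},D}\subset H^1_D(\Omega)$. The dual cell, also denoted $K$, is $\{x\in\Omega: e_K(x)>e_L(x)\ \forall L\ne K\}$, with measure $|K|$. $\phi^D_{\mathcal{T}}\in V_{\mathcal{T}}$ is a given discrete lifting and $(\phi^D_{\mathcal{T}})_K=\phi^D_{\mathcal{T}}(x_K)$. Time sequence: $0=t^0<t^1<\dots<t^{N_T}=T$, $\tau^k=t^k-t^{k-1}$. **Scheme.** Unknowns: reals $\mu_{i,K}^k$ ($i=1,\dots,n$) and $\phi_K^k$, $K\in\mathcal{M}$, $k=1,\dots,N_T$. (S1) $u_{i,K}^0=\frac1{|K|}\int_K u_i^{\rm ini}\,dx$, $i=0,\dots,n$. (S2) $u_{0,K}^k=\frac{1}{1+\sum_{j=1}^n\exp(\mu_{j,K}^k)}$ and $u_{i,K}^k=u_{0,K}^k\exp(\mu_{i,K}^k)$, $i=1,\dots,n$, $k\ge1$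 (so $\sum_{i=0}^n u_{i,K}^k=1$). (S3) for $i=1,\dots,n$, $K\in\mathcal{M}$, $k=1,\dots,N_T$: $|K|\frac{u_{i,K}^k-u_{i,K}^{k-1}}{\tau^k}+\sum_{S\in\mathcal{T}_K}\sum_{L\in\mathcal{M}_S}u_{0,S}^k u_{i,S}^k F_{i,K,L}^{k,S}=0$. (S4) $F_{i,K,L}^{k,S}=D_i a_{KL}^S\big((\mu_{i,K}^k-\mu_{i,L}^k)+\beta z_i(\phi_K^k-\phi_L^k)\big)$ with $a_{KL}^S=-|S|\nabla e_K(S)\cdot\nabla e_L(S)$. (S5) Either (max): $u_{j,S}^k=\max_{L\in\mathcal{M}_S}u_{j,L}^k$ for $j=0,\dots,n$; or (ave): $u_{j,S}^k=\frac1{d+1}\sum_{L\in\mathcal{M}_S}u_{j,L}^k$ for $j=0,\dots,n$. (S6) $\phi_K^k=(\phi^D_{\mathcal{T}})_K$ for $K\in\mathcal{M}_D$, and $\lambda^2\sum_{S\in\mathcal{T}_K}\sum_{L\in\mathcal{M}_S}a_{KL}^S(\phi_K^k-\phi_L^k)=|K|\sum_{i=1}^n z_iu_{i,K}^k+\int_K f\,dx$ for $K\in\mathcal{M}\setminus\mathcal{M}_D$. *)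

theory Defs
  imports "HOL-Analysis.Analysis"
begin

section \<open>Lebesgue and Sobolev spaces\<close>

text \<open>Elements of function spaces on \<open>\<Omega>\<close> are represented by functions on the whole space, of which
  only the values on \<open>\<Omega>\<close> matter.\<close>

definition L2 :: "'a measure \<Rightarrow> ('a \<Rightarrow> 'b::euclidean_space) set" where
  "L2 M = {v. v \<in> borel_measurable M \<and> integrable M (\<lambda>x. (norm (v x))\<^sup>2)}"

definition L2_norm :: "'a measure \<Rightarrow> ('a \<Rightarrow> 'b::euclidean_space) \<Rightarrow> real" where
  "L2_norm M v = sqrt (\<integral>x. (norm (v x))\<^sup>2 \<partial>M)"

definition Linfty :: "'a measure \<Rightarrow> ('a \<Rightarrow> real) set" where
  "Linfty M = {v. v \<in> borel_measurable M \<and> (\<exists>C. AE x in M. \<bar>v x\<bar> \<le> C)}"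

definition grad :: "(real^'d \<Rightarrow> real) \<Rightarrow> real^'d \<Rightarrow> real^'d" where
  "grad f x = (\<chi> i. frechet_derivative f (at x) (axis i 1))"

text \<open>Functions of class \<open>C\<^sup>\<infinity>\<close>: differentiable everywhere, with partial derivatives that are again
  of class \<open>C\<^sup>\<infinity>\<close> (greatest fixed point).\<close>

coinductive smooth :: "(real^'d \<Rightarrow> real) \<Rightarrow> bool" where
  "\<lbrakk>\<And>x. f differentiable at x; \<And>i. smooth (\<lambda>x. grad f x $ i)\<rbrakk> \<Longrightarrow> smooth f"

definition test_function :: "(real^'d) set \<Rightarrow> (real^'d \<Rightarrow> real) \<Rightarrow> bool" where
  "test_function \<Omega> \<psi> \<longleftrightarrow>
     smooth \<psi> \<and> compact (closure {x. \<psi> x \<noteq> 0}) \<and> closure {x. \<psi> x \<noteq> 0} \<subseteq> \<Omega>"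

definition weak_gradient ::
  "(real^'d) set \<Rightarrow> (real^'d \<Rightarrow> real) \<Rightarrow> (real^'d \<Rightarrow> real^'d) \<Rightarrow> bool" where
  "weak_gradient \<Omega> v G \<longleftrightarrow>
     G \<in> L2 (lebesgue_on \<Omega>) \<and>
     (\<forall>\<psi> i. test_function \<Omega> \<psi> \<longrightarrow>
        (\<integral>x. v x * grad \<psi> x $ i \<partial>lebesgue_on \<Omega>) = - (\<integral>x. G x $ i * \<psi> x \<partial>lebesgue_on \<Omega>))"

definition H1 :: "(real^'d) set \<Rightarrow> (real^'d \<Rightarrow> real) set" where
  "H1 \<Omega> = {v \<in> L2 (lebesgue_on \<Omega>). \<exists>G. weak_gradient \<Omega> v G}"

section \<open>Surface measure and traces\<close>

definition hausdorff_premeasure :: "nat \<Rightarrow> real \<Rightarrow> 'a::euclidean_space set \<Rightarrow> ennreal" where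
  "hausdorff_premeasure s \<delta> A =
     (INF U \<in> {U :: nat \<Rightarrow> 'a set. A \<subseteq> (\<Union>m. U m) \<and> (\<forall>m. bounded (U m) \<and> diameter (U m) < \<delta>)}.
        \<Sum>m. if U m = {} then 0
            else ennreal (unit_ball_vol (real s) * (diameter (U m) / 2) ^ s))"

definition hausdorff_measure :: "nat \<Rightarrow> 'a::euclidean_space measure" where
  "hausdorff_measure s =
     measure_of UNIV (sets borel) (\<lambda>A. SUP \<delta> \<in> {0<..}. hausdorff_premeasure s \<delta> A)"

definition surface_measure :: "(real^'d) set \<Rightarrow> (real^'d) measure" where
  "surface_measure \<Omega> = restrict_space (hausdorff_measure (CARD('d) - 1)) (frontier \<Omega>)"

text \<open>The trace operator on a bounded Lipschitz domain is the continuous extension, from \<open>H\<^sup>1(\<Omega>)\<close> to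
  \<open>L\<^sup>2(\<partial>\<Omega>)\<close>, of the restriction to \<open>\<partial>\<Omega>\<close> of functions that are smooth up to the boundary.
  The following is its graph.\<close>

definition has_trace :: "(real^'d) set \<Rightarrow> (real^'d \<Rightarrow> real) \<Rightarrow> (real^'d \<Rightarrow> real) \<Rightarrow> bool" where
  "has_trace \<Omega> v g \<longleftrightarrow>
     v \<in> L2 (lebesgue_on \<Omega>) \<and> g \<in> L2 (surface_measure \<Omega>) \<and>
     (\<exists>G w. weak_gradient \<Omega> v G \<and> (\<forall>m::nat. smooth (w m)) \<and>
        (\<lambda>m. L2_norm (lebesgue_on \<Omega>) (\<lambda>x. w m x - v x)) \<longlonglongrightarrow> 0 \<and>
        (\<lambda>m. L2_norm (lebesgue_on \<Omega>) (\<lambda>x. grad (w m) x - G x)) \<longlonglongrightarrow> 0 \<and>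
        (\<lambda>m. L2_norm (surface_measure \<Omega>) (\<lambda>x. w m x - g x)) \<longlonglongrightarrow> 0)"

definition H1_D :: "(real^'d) set \<Rightarrow> (real^'d) set \<Rightarrow> (real^'d \<Rightarrow> real) set" where
  "H1_D \<Omega> \<Gamma>\<^sub>D =
     {v \<in> H1 \<Omega>. \<exists>g. has_trace \<Omega> v g \<and> (AE x in surface_measure \<Omega>. x \<in> \<Gamma>\<^sub>D \<longrightarrow> g x = 0)}"

definition poincare_inequality :: "(real^'d) set \<Rightarrow> (real^'d) set \<Rightarrow> bool" where
  "poincare_inequality \<Omega> \<Gamma>\<^sub>D \<longleftrightarrow>
     (\<exists>C>0. \<forall>v \<in> H1_D \<Omega> \<Gamma>\<^sub>D. \<forall>G. weak_gradient \<Omega> v G \<longrightarrow>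
        L2_norm (lebesgue_on \<Omega>) v \<le> C * L2_norm (lebesgue_on \<Omega>) G)"

section \<open>Domain\<close>

definition polytopal :: "(real^'d) set \<Rightarrow> bool" where
  "polytopal \<Omega> \<longleftrightarrow> (\<exists>\<P>. finite \<P> \<and> (\<forall>P\<in>\<P>. polytope P) \<and> \<Omega> = interior (\<Union>\<P>))"

text \<open>Near each boundary point, \<open>\<Omega>\<close> is the strict epigraph of a Lipschitz function \<open>\<gamma>\<close> in some
  direction \<open>e\<close>; \<open>\<gamma>\<close> is only evaluated on the hyperplane orthogonal to \<open>e\<close>.\<close>

definition lipschitz_boundary :: "(real^'d) set \<Rightarrow> bool" where
  "lipschitz_boundary \<Omega> \<longleftrightarrow>
     (\<forall>x \<in> frontier \<Omega>. \<exists>r>0. \<exists>e. norm e = 1 \<and> (\<exists>\<gamma> C. C-lipschitz_on {y. y \<bullet> e = 0} \<gamma> \<and>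
        \<Omega> \<inter> ball x r = {y \<in> ball x r. \<gamma> (y - (y \<bullet> e) *\<^sub>R e) < y \<bullet> e}))"

text \<open>The partition of \<open>\<partial>\<Omega>\<close> is regular in the sense that the interface between its two parts is
  negligible for the surface measure.\<close>

definition regular_partition :: "(real^'d) set \<Rightarrow> (real^'d) set \<Rightarrow> (real^'d) set \<Rightarrow> bool" where
  "regular_partition \<Omega> \<Gamma>\<^sub>D \<Gamma>\<^sub>N \<longleftrightarrow>
     \<Gamma>\<^sub>D \<union> \<Gamma>\<^sub>N = frontier \<Omega> \<and> \<Gamma>\<^sub>D \<inter> \<Gamma>\<^sub>N = {} \<and>
     closure \<Gamma>\<^sub>D \<inter> closure \<Gamma>\<^sub>N \<in> null_sets (surface_measure \<Omega>)"

section \<open>Simplicial mesh and conforming finite elements\<close>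

definition open_simplex :: "(real^'d) set \<Rightarrow> bool" where
  "open_simplex S \<longleftrightarrow> (\<exists>P. int CARD('d) simplex P \<and> S = interior P)"

definition simplicial_mesh :: "(real^'d) set \<Rightarrow> (real^'d) set set \<Rightarrow> bool" where
  "simplicial_mesh \<Omega> \<T> \<longleftrightarrow>
     finite \<T> \<and> (\<forall>S\<in>\<T>. open_simplex S) \<and> disjoint \<T> \<and> (\<Union>S\<in>\<T>. closure S) = closure \<Omega> \<and>
     (\<forall>S\<in>\<T>. \<forall>S'\<in>\<T>. closure S \<inter> closure S' face_of closure S)"

definition vertices :: "(real^'d) set \<Rightarrow> (real^'d) set" where
  "vertices S = {x. x extreme_point_of closure S}"

text \<open>Vertices serve as their own indices: \<open>K\<close> and \<open>x\<^sub>K\<close> are identified.\<close>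

definition mesh_vertices :: "(real^'d) set set \<Rightarrow> (real^'d) set" where
  "mesh_vertices \<T> = (\<Union>S\<in>\<T>. vertices S)"

definition patch :: "(real^'d) set set \<Rightarrow> real^'d \<Rightarrow> (real^'d) set set" where
  "patch \<T> K = {S \<in> \<T>. K \<in> vertices S}"

text \<open>The value 0 outside \<open>closure \<Omega>\<close> is a convention making a finite element function determined by
  its nodal values as a function on the whole space.\<close>

definition P1_space :: "(real^'d) set \<Rightarrow> (real^'d) set set \<Rightarrow> (real^'d \<Rightarrow> real) set" where
  "P1_space \<Omega> \<T> =
     {v. continuous_on (closure \<Omega>) v \<and> (\<forall>S\<in>\<T>. \<exists>a b. \<forall>x\<in>S. v x = a \<bullet> x + b) \<and>
         (\<forall>x. x \<notin> closure \<Omega> \<longrightarrow> v x = 0)}"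

definition P1_space_D ::
  "(real^'d) set \<Rightarrow> (real^'d) set set \<Rightarrow> (real^'d) set \<Rightarrow> (real^'d \<Rightarrow> real) set" where
  "P1_space_D \<Omega> \<T> \<Gamma>\<^sub>D = {v \<in> P1_space \<Omega> \<T>. \<forall>K \<in> mesh_vertices \<T> \<inter> \<Gamma>\<^sub>D. v K = 0}"

definition nodal_basis :: "(real^'d) set \<Rightarrow> (real^'d) set set \<Rightarrow> real^'d \<Rightarrow> real^'d \<Rightarrow> real" where
  "nodal_basis \<Omega> \<T> K =
     (THE v. v \<in> P1_space \<Omega> \<T> \<and> (\<forall>L \<in> mesh_vertices \<T>. v L = (if L = K then 1 else 0)))"

definition cell_grad :: "(real^'d \<Rightarrow> real) \<Rightarrow> (real^'d) set \<Rightarrow> real^'d" where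
  "cell_grad v S = (THE g. \<forall>x\<in>S. grad v x = g)"

definition dual_cell :: "(real^'d) set \<Rightarrow> (real^'d) set set \<Rightarrow> real^'d \<Rightarrow> (real^'d) set" where
  "dual_cell \<Omega> \<T> K =
     {x \<in> \<Omega>. \<forall>L \<in> mesh_vertices \<T>. L \<noteq> K \<longrightarrow> nodal_basis \<Omega> \<T> K x > nodal_basis \<Omega> \<T> L x}"

definition stiffness ::
  "(real^'d) set \<Rightarrow> (real^'d) set set \<Rightarrow> (real^'d) set \<Rightarrow> real^'d \<Rightarrow> real^'d \<Rightarrow> real" where
  "stiffness \<Omega> \<T> S K L =
     - measure lebesgue S *
       (cell_grad (nodal_basis \<Omega> \<T> K) S \<bullet> cell_grad (nodal_basis \<Omega> \<T> L) S)"

definition time_sequence :: "real \<Rightarrow> nat \<Rightarrow> (nat \<Rightarrow> real) \<Rightarrow> bool" where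
  "time_sequence T N t \<longleftrightarrow> t 0 = 0 \<and> t N = T \<and> (\<forall>k<N. t k < t (Suc k))"

section \<open>The CVFE scheme\<close>

datatype mobility = Maximum | Average

fun cell_value :: "mobility \<Rightarrow> (real^'d \<Rightarrow> real) \<Rightarrow> (real^'d) set \<Rightarrow> real" where
  "cell_value Maximum w S = Max (w ` vertices S)"
| "cell_value Average w S = (\<Sum>L\<in>vertices S. w L) / (real CARD('d) + 1)"

text \<open>Argument order of discrete unknowns: time index \<open>k\<close>, species \<open>i\<close>, vertex \<open>K\<close>. The species
  0 is the solvent; \<open>\<mu> k i K\<close> is only used for \<open>1 \<le> k \<le> N\<close> and \<open>1 \<le> i \<le> n\<close>.\<close>

definition concentration ::
  "(real^'d) set \<Rightarrow> (real^'d) set set \<Rightarrow> nat \<Rightarrow> (nat \<Rightarrow> real^'d \<Rightarrow> real) \<Rightarrow>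
   (nat \<Rightarrow> nat \<Rightarrow> real^'d \<Rightarrow> real) \<Rightarrow> nat \<Rightarrow> nat \<Rightarrow> real^'d \<Rightarrow> real" where
  "concentration \<Omega> \<T> n u_ini \<mu> k i K =
     (if k = 0 then
        (\<integral>x. u_ini i x \<partial>lebesgue_on (dual_cell \<Omega> \<T> K)) / measure lebesgue (dual_cell \<Omega> \<T> K)
      else
        (let u0 = 1 / (1 + (\<Sum>j=1..n. exp (\<mu> k j K)))
         in if i = 0 then u0 else u0 * exp (\<mu> k i K)))"

definition flux ::
  "(real^'d) set \<Rightarrow> (real^'d) set set \<Rightarrow> (nat \<Rightarrow> real) \<Rightarrow> (nat \<Rightarrow> real) \<Rightarrow> real \<Rightarrow>
   (nat \<Rightarrow> nat \<Rightarrow> real^'d \<Rightarrow> real) \<Rightarrow> (nat \<Rightarrow> real^'d \<Rightarrow> real) \<Rightarrow>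
   nat \<Rightarrow> (real^'d) set \<Rightarrow> nat \<Rightarrow> real^'d \<Rightarrow> real^'d \<Rightarrow> real" where
  "flux \<Omega> \<T> D z \<beta> \<mu> \<phi> k S i K L =
     D i * stiffness \<Omega> \<T> S K L * ((\<mu> k i K - \<mu> k i L) + \<beta> * z i * (\<phi> k K - \<phi> k L))"

definition cvfe_solution ::
  "(real^'d) set \<Rightarrow> (real^'d) set \<Rightarrow> (real^'d) set set \<Rightarrow> nat \<Rightarrow> (nat \<Rightarrow> real) \<Rightarrow> (nat \<Rightarrow> real) \<Rightarrow>
   real \<Rightarrow> real \<Rightarrow> (nat \<Rightarrow> real^'d \<Rightarrow> real) \<Rightarrow> (real^'d \<Rightarrow> real) \<Rightarrow> (real^'d \<Rightarrow> real) \<Rightarrow>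
   nat \<Rightarrow> (nat \<Rightarrow> real) \<Rightarrow> mobility \<Rightarrow>
   (nat \<Rightarrow> nat \<Rightarrow> real^'d \<Rightarrow> real) \<Rightarrow> (nat \<Rightarrow> real^'d \<Rightarrow> real) \<Rightarrow> bool" where
  "cvfe_solution \<Omega> \<Gamma>\<^sub>D \<T> n z D lam \<beta> u_ini f \<phi>\<^sub>D\<^sub>T N t mob \<mu> \<phi> \<longleftrightarrow>
     (let u = concentration \<Omega> \<T> n u_ini \<mu>;
          vol = (\<lambda>K. measure lebesgue (dual_cell \<Omega> \<T> K))
      in \<forall>k\<in>{1..N}.
        (\<forall>i\<in>{1..n}. \<forall>K\<in>mesh_vertices \<T>.
           vol K * ((u k i K - u (k - 1) i K) / (t k - t (k - 1))) +
           (\<Sum>S\<in>patch \<T> K. \<Sum>L\<in>vertices S.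
              cell_value mob (u k 0) S * cell_value mob (u k i) S *
              flux \<Omega> \<T> D z \<beta> \<mu> \<phi> k S i K L) = 0) \<and>
        (\<forall>K \<in> mesh_vertices \<T> \<inter> \<Gamma>\<^sub>D. \<phi> k K = \<phi>\<^sub>D\<^sub>T K) \<and>
        (\<forall>K \<in> mesh_vertices \<T> - \<Gamma>\<^sub>D.
           lam\<^sup>2 * (\<Sum>S\<in>patch \<T> K. \<Sum>L\<in>vertices S.
                    stiffness \<Omega> \<T> S K L * (\<phi> k K - \<phi> k L)) =
           vol K * (\<Sum>i=1..n. z i * u k i K) + (\<integral>x. f x \<partial>lebesgue_on (dual_cell \<Omega> \<T> K))))"

end

theory Submission
  imports Defs
begin

text \<open>Existence is reduced to a single time step, posed on a box in the chemical potentials and the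
  electric potential. Kuhn's combinatorial lemma, the core of Brouwer's theorem, yields a point of
  the box at which every equation has zero residual, except that a coordinate on a face of the box
  may have a residual of the sign opposite to its own. Testing the Poisson residuals with the
  deviation of the potential from its Dirichlet data gives a bound for the potential that does not
  depend on the box. Testing the species residuals with the electrochemical potentials gives a bound for the dissipation and shows that the total
  residual is \<open>O(1/B)\<close> when the chemical potentials are confined to \<open>[-B, B]\<close>. For large \<open>B\<close> each
  species therefore keeps half of its mass, so it has a non-negligible concentration at some vertex.
  The dissipation bound propagates this lower bound through the connected mesh, first for the
  solvent and then for the other species, and so bounds the chemical potentials independently of
  \<open>B\<close>. Hence for large \<open>B\<close> no coordinate touches a face, and all residuals vanish.\<close>

section \<open>A variational inequality on a box\<close>

text \<open>The mobility of species \<open>i\<close> degenerates wherever the solvent or the species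
  itself is rare, so the dissipation alone does not control the potentials: some concentration must
  first be known to be non-negligible, and only the mass balance provides that. On a box this
  balance is perturbed by the residuals on the faces. A residual \<open>F\<close> at a face
  satisfies \<open>F * x = - B * |F|\<close>, so testing puts \<open>B\<close> times the total
  residual on the same side as the dissipation, and a common quantity \<open>E\<close> bounds both.
  \<open>E\<close> is independent of \<open>B\<close> because the concentrations are the softmax of
  the potentials: the time difference is bounded below through the entropy, however large the
  potentials are. Hence the choice of constants is not circular: the bounds for the electric
  potential, the dissipation, the mass fraction and the chemical potentials are all fixed before
  \<open>B\<close>. The stiffness coefficients may have either sign; coercivity comes from squared
  cell gradients, as each mobility is constant on its cell.\<close>

lemma tendsto_fun_iff:
  fixes X :: "nat \<Rightarrow> 'i \<Rightarrow> real"
  shows "X \<longlonglongrightarrow> x \<longleftrightarrow> (\<forall>i. (\<lambda>k. X k i) \<longlonglongrightarrow> x i)"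
  using limitin_componentwise[of "\<lambda>_. euclidean :: real topology" UNIV X x sequentially]
  by (simp add: euclidean_product_topology)

text \<open>The dimension is a value here, not a type, so Brouwer's theorem for Euclidean spaces does not
  apply. A grid point is labelled in direction \<open>i\<close> by the face it lies on, and by the sign of \<open>F i\<close> if
  it lies on none; small grid cells carrying both labels in every direction accumulate at \<open>x\<close>.\<close>

lemma box_variational_nat:
  fixes F :: "nat \<Rightarrow> (nat \<Rightarrow> real) \<Rightarrow> real" and b :: "nat \<Rightarrow> real"
  assumes b: "\<And>i. i < m \<Longrightarrow> b i > 0" and cont: "\<And>i. i < m \<Longrightarrow> continuous_on UNIV (F i)"
  obtains x where "\<And>i. i < m \<Longrightarrow> \<bar>x i\<bar> \<le> b i"
    and "\<And>i. i < m \<Longrightarrow> x i < b i \<Longrightarrow> F i x \<ge> 0"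
    and "\<And>i. i < m \<Longrightarrow> - b i < x i \<Longrightarrow> F i x \<le> 0"
proof -
  \<comment> \<open>Setting the coordinates from \<open>m\<close> on to 0 keeps all grid points in a
    compact product of intervals inside the infinite-dimensional space of functions on
    \<open>nat\<close>.\<close>
  define pt where "pt p q = (\<lambda>i. if i < m then b i * (2 * real (q i) / real p - 1) else 0)"
    for p :: nat and q :: "nat \<Rightarrow> nat"
  define label where "label p q i =
      (if q i = 0 then 0 else if q i = p then 1 else if F i (pt p q) \<le> 0 then 0 else 1 :: nat)"
    for p :: nat and q :: "nat \<Rightarrow> nat" and i
  define near where "near q r \<longleftrightarrow> (\<forall>j<m. q j \<le> r j \<and> r j \<le> q j + 1)" for q r :: "nat \<Rightarrow> nat"
  have "\<exists>q. (\<forall>i<m. q i < Suc k) \<and>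
      (\<forall>i<m. \<exists>r s. near q r \<and> near q s \<and> label (Suc k) r i = 0 \<and> label (Suc k) s i = 1)" for k
  proof -
    obtain q where q: "\<forall>i<m. q i < Suc k"
      "\<forall>i<m. \<exists>r s. near q r \<and> near q s \<and> label (Suc k) r i \<noteq> label (Suc k) s i"
      unfolding near_def
      by (rule kuhn_lemma[of "Suc k" m "label (Suc k)"]) (auto simp: label_def)
    have "label (Suc k) r i = 0 \<or> label (Suc k) r i = 1" for r i
      by (simp add: label_def)
    then show ?thesis using q by metis
  qed
  then obtain Q where Q: "\<And>k i. i < m \<Longrightarrow> Q k i < Suc k"
    and RS: "\<And>k i. i < m \<Longrightarrow> \<exists>r s. near (Q k) r \<and> near (Q k) s \<and>
        label (Suc k) r i = 0 \<and> label (Suc k) s i = 1"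
    by metis
  define R where "R k i = (SOME r. near (Q k) r \<and> label (Suc k) r i = 0)" for k i
  define S where "S k i = (SOME s. near (Q k) s \<and> label (Suc k) s i = 1)" for k i
  have R: "near (Q k) (R k i)" and lR: "label (Suc k) (R k i) i = 0" if "i < m" for k i
    using someI_ex[of "\<lambda>r. near (Q k) r \<and> label (Suc k) r i = 0"] RS[OF that, of k]
    by (auto simp: R_def)
  have S: "near (Q k) (S k i)" and lS: "label (Suc k) (S k i) i = 1" if "i < m" for k i
    using someI_ex[of "\<lambda>s. near (Q k) s \<and> label (Suc k) s i = 1"] RS[OF that, of k]
    by (auto simp: S_def)
  define X where "X k = pt (Suc k) (Q k)" for k
  define C where "C = PiE UNIV (\<lambda>i. {- (if i < m then b i else 0)..if i < m then b i else 0})"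
  have "compact C"
    using compactin_PiE[of "\<lambda>_::nat. euclidean :: real topology" UNIV
        "\<lambda>i. {- (if i < m then b i else 0)..if i < m then b i else 0}"]
    by (simp add: C_def euclidean_product_topology)
  moreover have XC: "X k \<in> C" for k
  proof -
    have "\<bar>X k i\<bar> \<le> b i" if "i < m" for i
    proof -
      have "0 \<le> real (Q k i) / real (Suc k)" "real (Q k i) / real (Suc k) \<le> 1"
        using Q[OF that, of k] by auto
      then have "\<bar>2 * (real (Q k i) / real (Suc k)) - 1\<bar> \<le> 1" by linarith
      then show ?thesis
        using b[OF that] by (simp add: X_def pt_def that abs_mult mult_left_le)
    qed
    then show ?thesis
      by (auto simp: C_def PiE_def abs_le_iff X_def pt_def minus_le_iff)
  qed
  ultimately obtain x \<sigma> where x: "x \<in> C" and \<sigma>: "strict_mono \<sigma>" and lim: "(X \<circ> \<sigma>) \<longlonglongrightarrow> x"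
    unfolding compact_eq_seq_compact_metric seq_compact_def by blast
  \<comment> \<open>Corners of the \<open>k\<close>-th cell differ from its base point by at most
    \<open>2 * b i / Suc k\<close> in coordinate \<open>i\<close>, so every choice of corners has
    the same limit \<open>x\<close>.\<close>
  have nearlim: "(\<lambda>k. pt (Suc (\<sigma> k)) (r (\<sigma> k))) \<longlonglongrightarrow> x"
    if r: "\<And>k. near (Q k) (r k)" for r
    unfolding tendsto_fun_iff
  proof
    fix i
    show "(\<lambda>k. pt (Suc (\<sigma> k)) (r (\<sigma> k)) i) \<longlonglongrightarrow> x i"
    proof (cases "i < m")
      case True
      have "(\<lambda>k. 2 * b i / real (Suc k)) \<longlonglongrightarrow> 0"
        by (rule LIMSEQ_Suc[OF lim_const_over_n])
      then have lim0: "((\<lambda>k. 2 * b i / real (Suc k)) \<circ> \<sigma>) \<longlonglongrightarrow> 0"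
        by (rule LIMSEQ_subseq_LIMSEQ[OF _ \<sigma>])
      have "\<forall>\<^sub>F k in sequentially. norm (pt (Suc (\<sigma> k)) (r (\<sigma> k)) i - (X \<circ> \<sigma>) k i)
          \<le> ((\<lambda>k. 2 * b i / real (Suc k)) \<circ> \<sigma>) k"
      proof (intro always_eventually allI)
        fix k
        let ?K = "\<sigma> k"
        have "pt (Suc ?K) (r ?K) i - X ?K i =
            2 * b i / real (Suc ?K) * (real (r ?K i) - real (Q ?K i))"
          using True by (simp add: X_def pt_def diff_divide_distrib algebra_simps del: of_nat_Suc)
        moreover have "\<bar>real (r ?K i) - real (Q ?K i)\<bar> \<le> 1"
          using r[of ?K] True unfolding near_def by force
        ultimately show "norm (pt (Suc ?K) (r ?K) i - (X \<circ> \<sigma>) k i)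
            \<le> ((\<lambda>k. 2 * b i / real (Suc k)) \<circ> \<sigma>) k"
          using b[OF True] by (simp add: abs_mult mult_left_le divide_right_mono)
      qed
      from Lim_null_comparison[OF this lim0]
      have "(\<lambda>k. pt (Suc (\<sigma> k)) (r (\<sigma> k)) i - (X \<circ> \<sigma>) k i) \<longlonglongrightarrow> 0" .
      from tendsto_add[OF this lim[unfolded tendsto_fun_iff, rule_format, of i]]
      show ?thesis by simp
    next
      case False
      then have "x i = 0" using PiE_mem[OF x[unfolded C_def], of i] by simp
      then show ?thesis using False by (simp add: pt_def)
    qed
  qed
  have Flim: "(\<lambda>k. F i (pt (Suc (\<sigma> k)) (r (\<sigma> k)))) \<longlonglongrightarrow> F i x"
    if "i < m" "\<And>k. near (Q k) (r k)" for r i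
    using continuous_on_tendsto_compose[OF cont[OF that(1)] nearlim[OF that(2)]] by simp
  show ?thesis
  proof (rule that[of x])
    fix i assume i: "i < m"
    show "\<bar>x i\<bar> \<le> b i"
      using PiE_mem[OF x[unfolded C_def], of i] i by (simp add: abs_le_iff minus_le_iff)
    \<comment> \<open>Below the upper face the corners \<open>S\<close> are eventually off that
      face, so their label 1 can only come from \<open>F i > 0\<close>. The other inequality is
      symmetric, with the corners \<open>R\<close>.\<close>
    show "F i x \<ge> 0" if "x i < b i"
    proof (rule tendsto_lowerbound[OF Flim[OF i S[OF i]]])
      have "(\<lambda>k. pt (Suc (\<sigma> k)) (S (\<sigma> k) i) i) \<longlonglongrightarrow> x i"
        using nearlim[OF S[OF i]] by (simp add: tendsto_fun_iff)
      from order_tendstoD(2)[OF this that]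
      show "\<forall>\<^sub>F k in sequentially. 0 \<le> F i (pt (Suc (\<sigma> k)) (S (\<sigma> k) i))"
      proof eventually_elim
        case (elim k)
        then have "S (\<sigma> k) i i \<noteq> Suc (\<sigma> k)"
          using i by (auto simp: pt_def simp del: of_nat_Suc)
        then show ?case
          using lS[OF i, of "\<sigma> k"] by (auto simp: label_def split: if_splits)
      qed
    qed simp
    show "F i x \<le> 0" if "- b i < x i"
    proof (rule tendsto_upperbound[OF Flim[OF i R[OF i]]])
      have "(\<lambda>k. pt (Suc (\<sigma> k)) (R (\<sigma> k) i) i) \<longlonglongrightarrow> x i"
        using nearlim[OF R[OF i]] by (simp add: tendsto_fun_iff)
      from order_tendstoD(1)[OF this that]
      show "\<forall>\<^sub>F k in sequentially. F i (pt (Suc (\<sigma> k)) (R (\<sigma> k) i)) \<le> 0"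
      proof eventually_elim
        case (elim k)
        then have "R (\<sigma> k) i i \<noteq> 0"
          using i by (intro notI) (simp add: pt_def)
        then show ?case
          using lR[OF i, of "\<sigma> k"] by (auto simp: label_def split: if_splits)
      qed
    qed simp
  qed
qed

text \<open>Transport along a bijection of \<open>I\<close> with \<open>{..<card I}\<close>. The
  product form of the last conclusion covers faces and interior at once and can be summed when
  residuals are tested with \<open>x\<close>.\<close>

lemma box_variational:
  fixes F :: "'i \<Rightarrow> ('i \<Rightarrow> real) \<Rightarrow> real" and b :: "'i \<Rightarrow> real"
  assumes "finite I"
    and b: "\<And>i. i \<in> I \<Longrightarrow> b i > 0" and cont: "\<And>i. i \<in> I \<Longrightarrow> continuous_on UNIV (F i)"
  obtains x where "\<And>i. i \<in> I \<Longrightarrow> \<bar>x i\<bar> \<le> b i"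
    and "\<And>i. i \<in> I \<Longrightarrow> \<bar>x i\<bar> < b i \<Longrightarrow> F i x = 0"
    and "\<And>i. i \<in> I \<Longrightarrow> F i x * x i = - \<bar>F i x\<bar> * b i"
proof -
  obtain h where h: "bij_betw h {..<card I} I"
    using ex_bij_betw_nat_finite[OF assms(1)] by (auto simp: atLeast0LessThan)
  define g where "g = the_inv_into {..<card I} h"
  have hI: "h j \<in> I" "g (h j) = j" if "j < card I" for j
    using h that by (auto simp: g_def bij_betw_def the_inv_into_f_f)
  have gI: "g i < card I" "h (g i) = i" if "i \<in> I" for i
    using h that bij_betwE[OF bij_betw_the_inv_into[OF h]] f_the_inv_into_f_bij_betw[OF h]
    by (auto simp: g_def)
  have cont': "continuous_on UNIV (\<lambda>y::nat\<Rightarrow>real. F (h j) (\<lambda>i. y (g i)))" if "j < card I" for j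
    by (rule continuous_on_compose2[OF cont[OF hI(1)[OF that]]])
      (auto intro!: continuous_on_coordinatewise_then_product)
  obtain y where y: "\<And>j. j < card I \<Longrightarrow> \<bar>y j\<bar> \<le> b (h j)"
    "\<And>j. j < card I \<Longrightarrow> y j < b (h j) \<Longrightarrow> F (h j) (\<lambda>i. y (g i)) \<ge> 0"
    "\<And>j. j < card I \<Longrightarrow> - b (h j) < y j \<Longrightarrow> F (h j) (\<lambda>i. y (g i)) \<le> 0"
    by (rule box_variational_nat[of "card I" "\<lambda>j. b (h j)" "\<lambda>j y. F (h j) (\<lambda>i. y (g i))"])
      (use b hI cont' in auto)
  show ?thesis
  proof (rule that[of "\<lambda>i. y (g i)"])
    fix i assume i: "i \<in> I"
    show "\<bar>y (g i)\<bar> \<le> b i" using y(1)[of "g i"] gI[OF i] by simp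
    have sgn: "F i (\<lambda>i. y (g i)) \<ge> 0" if "y (g i) < b i"
      using y(2)[of "g i"] gI[OF i] that by simp
    have sgn': "F i (\<lambda>i. y (g i)) \<le> 0" if "- b i < y (g i)"
      using y(3)[of "g i"] gI[OF i] that by simp
    show zero: "F i (\<lambda>i. y (g i)) = 0" if "\<bar>y (g i)\<bar> < b i"
      using sgn sgn' that by linarith
    have "\<bar>y (g i)\<bar> \<le> b i" using y(1)[of "g i"] gI[OF i] by simp
    then consider "\<bar>y (g i)\<bar> < b i" | "y (g i) = b i" | "y (g i) = - b i" by linarith
    then show "F i (\<lambda>i. y (g i)) * y (g i) = - \<bar>F i (\<lambda>i. y (g i))\<bar> * b i"
      by cases (use zero sgn sgn' b[OF i] in auto)
  qed
qed

section \<open>Abstract cell complexes\<close>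

text \<open>The later bounds propagate from vertex to vertex with growing constants. Here the
  constants of finitely many vertices, pairs of vertices or species become one; the sum of their
  absolute values dominates them all.\<close>

lemma finite_uniform_bound:
  fixes P :: "'a \<Rightarrow> real \<Rightarrow> bool"
  assumes "finite A" and "\<And>a. a \<in> A \<Longrightarrow> \<exists>C. P a C"
    and mono: "\<And>a C C'. P a C \<Longrightarrow> C \<le> C' \<Longrightarrow> P a C'"
  obtains C where "C \<ge> 0" and "\<And>a. a \<in> A \<Longrightarrow> P a C"
proof -
  obtain c where c: "\<And>a. a \<in> A \<Longrightarrow> P a (c a)" using assms(2) by metis
  have "P a (\<Sum>b\<in>A. \<bar>c b\<bar>)" if "a \<in> A" for a
    by (rule mono[OF c[OF that]])
      (use member_le_sum[OF that, of "\<lambda>b. \<bar>c b\<bar>"] assms(1) in \<open>auto intro: order_trans[OF abs_ge_self]\<close>)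
  then show ?thesis using that[of "\<Sum>b\<in>A. \<bar>c b\<bar>"] by (simp add: sum_nonneg)
qed

text \<open>Index 0 is the solvent, whose chemical potential is normalised to 0.\<close>

definition softmax :: "nat \<Rightarrow> (nat \<Rightarrow> 'v \<Rightarrow> real) \<Rightarrow> nat \<Rightarrow> 'v \<Rightarrow> real" where
  "softmax n \<mu> i K =
     (if i = 0 then 1 / (1 + (\<Sum>j=1..n. exp (\<mu> j K)))
      else 1 / (1 + (\<Sum>j=1..n. exp (\<mu> j K))) * exp (\<mu> i K))"

section \<open>Softmax: normalisation and the entropy estimate\<close>

lemma softmax_denom_pos: "0 < 1 + (\<Sum>j=1..n. exp (\<mu> j K :: real))"
  by (simp add: add_pos_nonneg sum_nonneg)

lemma softmax_pos: "softmax n \<mu> i K > 0"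
  using softmax_denom_pos[of \<mu> K n] by (simp add: softmax_def)

lemma softmax_sum: "softmax n \<mu> 0 K + (\<Sum>i=1..n. softmax n \<mu> i K) = 1"
proof -
  have "(\<Sum>i=1..n. softmax n \<mu> i K) = (\<Sum>i=1..n. 1 / (1 + (\<Sum>j=1..n. exp (\<mu> j K))) * exp (\<mu> i K))"
    by (intro sum.cong) (auto simp: softmax_def)
  then show ?thesis
    using softmax_denom_pos[of \<mu> K n]
    by (simp add: softmax_def sum_distrib_left[symmetric] sum_divide_distrib[symmetric]
        add_divide_distrib[symmetric])
qed

lemma softmax_le_1: "i \<le> n \<Longrightarrow> softmax n \<mu> i K \<le> 1"
proof (cases "i = 0")
  case True
  then show ?thesis
    using softmax_sum[of n \<mu> K] sum_nonneg[of "{1..n}" "\<lambda>i. softmax n \<mu> i K"]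
      softmax_pos[of n \<mu> _ K] by (simp add: less_imp_le)
next
  case False
  assume "i \<le> n"
  with False have "softmax n \<mu> i K \<le> (\<Sum>i=1..n. softmax n \<mu> i K)"
    by (intro member_le_sum) (auto intro: less_imp_le[OF softmax_pos])
  then show ?thesis using softmax_sum[of n \<mu> K] softmax_pos[of n \<mu> 0 K] by linarith
qed

lemma softmax_exp: "i \<noteq> 0 \<Longrightarrow> softmax n \<mu> i K = softmax n \<mu> 0 K * exp (\<mu> i K)"
  by (simp add: softmax_def)

text \<open>Stands in for the convexity inequality of the entropy. With the log-sum-exp function
  \<open>\<Psi> = ln Z\<close>, \<open>\<mu> i K = ln (softmax n \<mu> i K) + \<Psi>\<close>; as
  \<open>x * ln x\<close> is bounded below, the multiples of \<open>\<Psi>\<close> cancel up to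
  \<open>\<Psi> / Z \<le> 1\<close>. The bound is free of \<open>\<mu>\<close>.\<close>

lemma softmax_diff_inner_ge:
  assumes "\<And>i. i \<in> {1..n} \<Longrightarrow> v i \<ge> 0" "(\<Sum>i=1..n. v i) \<le> 1"
  shows "(\<Sum>i=1..n. (softmax n \<mu> i K - v i) * \<mu> i K) \<ge> - (real n + 1)"
proof -
  define Z where "Z = 1 + (\<Sum>j=1..n. exp (\<mu> j K))"
  define \<Psi> where "\<Psi> = ln Z"
  have Z: "Z \<ge> 1" by (simp add: Z_def sum_nonneg)
  have u0: "softmax n \<mu> 0 K = 1 / Z" by (simp add: softmax_def Z_def)
  \<comment> \<open>From \<open>ln (1 / x) \<le> 1 / x - 1\<close>, that is
    \<open>x * ln x \<ge> x - 1\<close>.\<close>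
  have xlnx: "x * ln x \<ge> - 1" if "x > 0" for x :: real
    using ln_add_one_self_le_self2[of "1/x - 1"] that
    by (simp add: field_simps ln_div)
  have \<mu>_le: "\<mu> i K \<le> \<Psi>" if "i \<in> {1..n}" for i
  proof -
    have "exp (\<mu> i K) \<le> (\<Sum>j=1..n. exp (\<mu> j K))"
      using that by (intro member_le_sum) auto
    then have "exp (\<mu> i K) \<le> Z" by (simp add: Z_def)
    then show ?thesis using Z by (simp add: \<Psi>_def ln_ge_iff)
  qed
  have \<Psi>0: "\<Psi> \<ge> 0" using Z by (simp add: \<Psi>_def)
  have "(\<Sum>i=1..n. v i * \<mu> i K) \<le> (\<Sum>i=1..n. v i * \<Psi>)"
    using \<mu>_le assms(1) by (intro sum_mono mult_left_mono) auto
  also have "\<dots> \<le> \<Psi>"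
    unfolding sum_distrib_right[symmetric]
    by (rule mult_left_le_one_le[OF \<Psi>0 sum_nonneg assms(2)]) (rule assms(1))
  finally have 1: "(\<Sum>i=1..n. v i * \<mu> i K) \<le> \<Psi>" .
  have "softmax n \<mu> i K * \<mu> i K \<ge> softmax n \<mu> i K * \<Psi> - 1" if "i \<in> {1..n}" for i
  proof -
    have "ln (softmax n \<mu> i K) = \<mu> i K - \<Psi>"
      using that Z u0 by (simp add: softmax_exp ln_div \<Psi>_def)
    from xlnx[OF softmax_pos[of n \<mu> i K], unfolded this] show ?thesis
      by (simp add: right_diff_distrib)
  qed
  then have "(\<Sum>i=1..n. softmax n \<mu> i K * \<mu> i K) \<ge> (\<Sum>i=1..n. softmax n \<mu> i K * \<Psi> - 1)"
    by (intro sum_mono)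
  also have "(\<Sum>i=1..n. softmax n \<mu> i K * \<Psi> - 1) = (1 - 1 / Z) * \<Psi> - real n"
    using softmax_sum[of n \<mu> K] u0
    by (simp add: sum_subtractf sum_distrib_right[symmetric])
  finally have 2: "(\<Sum>i=1..n. softmax n \<mu> i K * \<mu> i K) \<ge> \<Psi> - \<Psi> / Z - real n"
    by (simp add: algebra_simps)
  have "\<Psi> / Z \<le> 1"
    using Z ln_add_one_self_le_self2[of "Z - 1"] by (simp add: \<Psi>_def field_simps)
  then show ?thesis using 1 2 by (simp add: left_diff_distrib sum_subtractf)
qed

lemma continuous_on_softmax:
  assumes "\<And>j. j \<in> {1..n} \<Longrightarrow> continuous_on X (\<lambda>x. \<mu> x j K)" "i \<le> n"
  shows "continuous_on X (\<lambda>x. softmax n (\<mu> x) i K)"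
  using assms softmax_denom_pos[of _ K n]
  by (cases "i = 0") (auto simp: softmax_def less_imp_neq[symmetric] intro!: continuous_intros)

text \<open>The facts about the mesh on which the estimates rest. \<open>G S K\<close> stands for
  the gradient of the hat function of \<open>K\<close> on \<open>S\<close>; \<open>sum_G\<close>
  reflects the partition of unity, \<open>diff_le\<close> that a difference of nodal values is the
  cell gradient paired with an edge, and \<open>connected\<close> that cells are linked through
  shared vertices.\<close>

locale cell_complex =
  fixes M :: "'v set" and \<T> :: "'s set" and V :: "'s \<Rightarrow> 'v set"
    and G :: "'s \<Rightarrow> 'v \<Rightarrow> 'e::real_inner" and vol :: "'s \<Rightarrow> real" and c\<^sub>0 :: real
  assumes finite_M: "finite M" and finite_cells: "finite \<T>"
    and V_subset: "S \<in> \<T> \<Longrightarrow> V S \<subseteq> M"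
    and vol_pos: "S \<in> \<T> \<Longrightarrow> vol S > 0"
    and c0_pos: "c\<^sub>0 > 0"
    and sum_G: "S \<in> \<T> \<Longrightarrow> (\<Sum>L\<in>V S. G S L) = 0"
    and diff_le: "S \<in> \<T> \<Longrightarrow> K \<in> V S \<Longrightarrow> L \<in> V S \<Longrightarrow>
      \<bar>v K - v L\<bar> \<le> c\<^sub>0 * norm (\<Sum>J\<in>V S. v J *\<^sub>R G S J)"
    and connected: "R \<subseteq> M \<Longrightarrow> R \<noteq> {} \<Longrightarrow>
      (\<And>S. S \<in> \<T> \<Longrightarrow> V S \<inter> R \<noteq> {} \<Longrightarrow> V S \<subseteq> R) \<Longrightarrow> R = M"
begin

definition stiff :: "'s \<Rightarrow> 'v \<Rightarrow> 'v \<Rightarrow> real" where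
  "stiff S K L = - vol S * (G S K \<bullet> G S L)"

definition dgrad :: "'s \<Rightarrow> ('v \<Rightarrow> real) \<Rightarrow> 'e" where
  "dgrad S v = (\<Sum>J\<in>V S. v J *\<^sub>R G S J)"

definition energy :: "('v \<Rightarrow> real) \<Rightarrow> real" where
  "energy v = (\<Sum>S\<in>\<T>. vol S * (norm (dgrad S v))\<^sup>2)"

definition star :: "'v \<Rightarrow> 's set" where
  "star K = {S \<in> \<T>. K \<in> V S}"

lemma dgrad_add: "dgrad S (\<lambda>K. v K + w K) = dgrad S v + dgrad S w"
  by (simp add: dgrad_def scaleR_add_left sum.distrib)

text \<open>Because the \<open>G S L\<close> sum to 0, the terms with \<open>v K\<close> drop
  out.\<close>

lemma stiff_sum:
  assumes "S \<in> \<T>"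
  shows "(\<Sum>L\<in>V S. stiff S K L * (v K - v L)) = vol S * (G S K \<bullet> dgrad S v)"
proof -
  have "(\<Sum>L\<in>V S. stiff S K L * (v K - v L)) =
      - vol S * v K * (G S K \<bullet> (\<Sum>L\<in>V S. G S L)) + vol S * (G S K \<bullet> dgrad S v)"
    unfolding dgrad_def inner_sum_right sum_distrib_left sum.distrib[symmetric]
    by (intro sum.cong) (auto simp: stiff_def algebra_simps)
  then show ?thesis by (simp add: sum_G[OF assms])
qed

lemma sum_star_swap:
  "(\<Sum>K\<in>M. \<Sum>S\<in>star K. h K S) = (\<Sum>S\<in>\<T>. \<Sum>K\<in>V S. h K S)" for h :: "'v \<Rightarrow> 's \<Rightarrow> real"
proof -
  have "V S = {K \<in> M. K \<in> V S}" if "S \<in> \<T>" for S using V_subset[OF that] by auto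
  then show ?thesis
    unfolding star_def sum.swap_restrict[OF finite_M finite_cells] by (metis (no_types, lifting) sum.cong)
qed

text \<open>A weight constant on each cell passes through the summation, so for \<open>w = v\<close>
  each cell contributes its weight times a square, whatever the signs of the
  \<open>stiff S K L\<close>.\<close>

lemma summation_by_parts:
  "(\<Sum>K\<in>M. w K * (\<Sum>S\<in>star K. c S * (\<Sum>L\<in>V S. stiff S K L * (v K - v L)))) =
   (\<Sum>S\<in>\<T>. c S * (vol S * (dgrad S w \<bullet> dgrad S v)))"
proof -
  have "(\<Sum>K\<in>M. w K * (\<Sum>S\<in>star K. c S * (\<Sum>L\<in>V S. stiff S K L * (v K - v L)))) =
      (\<Sum>K\<in>M. \<Sum>S\<in>star K. w K * (c S * (vol S * (G S K \<bullet> dgrad S v))))"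
    unfolding sum_distrib_left[of _ _ "star _"]
    by (intro sum.cong refl) (simp add: stiff_sum star_def)
  also have "\<dots> = (\<Sum>S\<in>\<T>. \<Sum>K\<in>V S. w K * (c S * (vol S * (G S K \<bullet> dgrad S v))))"
    by (rule sum_star_swap)
  also have "\<dots> = (\<Sum>S\<in>\<T>. c S * (vol S * (dgrad S w \<bullet> dgrad S v)))"
    unfolding dgrad_def[of _ w] inner_sum_left sum_distrib_left
    by (intro sum.cong refl) (simp add: algebra_simps)
  finally show ?thesis .
qed

lemma norm_dgrad_le:
  assumes "S \<in> \<T>"
  shows "sqrt (vol S) * norm (dgrad S v) \<le> sqrt (energy v)"
proof -
  have "vol S * (norm (dgrad S v))\<^sup>2 \<le> energy v"
    unfolding energy_def
    by (rule member_le_sum[OF assms]) (auto intro!: mult_nonneg_nonneg less_imp_le[OF vol_pos] finite_cells)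
  then have "sqrt (vol S * (norm (dgrad S v))\<^sup>2) \<le> sqrt (energy v)" by simp
  then show ?thesis by (simp add: real_sqrt_mult)
qed

lemma energy_nonneg: "energy v \<ge> 0"
  unfolding energy_def by (auto intro!: sum_nonneg mult_nonneg_nonneg less_imp_le[OF vol_pos])

text \<open>Crossing a cell \<open>S\<close> adds at most \<open>c\<^sub>0 / sqrt (vol S)\<close> to
  the constant. So the vertices that admit a constant form a set that contains \<open>MD\<close> and
  is closed under cells, hence all of \<open>M\<close>.\<close>

lemma discrete_poincare:
  assumes "MD \<subseteq> M" "MD \<noteq> {}"
  obtains C where "C \<ge> 0"
    and "\<And>v K. \<forall>L\<in>MD. v L = 0 \<Longrightarrow> K \<in> M \<Longrightarrow> \<bar>v K\<bar> \<le> C * sqrt (energy v)"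
proof -
  define P where "P K C \<longleftrightarrow> (\<forall>v. (\<forall>L\<in>MD. v L = 0) \<longrightarrow> \<bar>v K\<bar> \<le> C * sqrt (energy v))" for K C
  have "{K \<in> M. \<exists>C. P K C} = M"
  proof (rule connected)
    have "P K 0" if "K \<in> MD" for K using that by (simp add: P_def)
    then show "{K \<in> M. \<exists>C. P K C} \<noteq> {}" using assms by blast
    fix S assume S: "S \<in> \<T>" "V S \<inter> {K \<in> M. \<exists>C. P K C} \<noteq> {}"
    then obtain K C where K: "K \<in> V S" and PK: "P K C" by blast
    have "P L (C + c\<^sub>0 / sqrt (vol S))" if L: "L \<in> V S" for L
      unfolding P_def
    proof (intro allI impI)
      fix v assume v: "\<forall>L\<in>MD. v L = (0::real)"
      have "\<bar>v L\<bar> \<le> \<bar>v K\<bar> + \<bar>v L - v K\<bar>" by linarith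
      also have "\<bar>v L - v K\<bar> \<le> c\<^sub>0 * norm (dgrad S v)"
        unfolding dgrad_def by (rule diff_le[OF S(1) L K])
      also have "norm (dgrad S v) \<le> sqrt (energy v) / sqrt (vol S)"
        using norm_dgrad_le[OF S(1), of v] vol_pos[OF S(1)] by (simp add: field_simps)
      also have "\<bar>v K\<bar> \<le> C * sqrt (energy v)" using PK v by (simp add: P_def)
      finally show "\<bar>v L\<bar> \<le> (C + c\<^sub>0 / sqrt (vol S)) * sqrt (energy v)"
        using c0_pos by (simp add: algebra_simps)
    qed
    then show "V S \<subseteq> {K \<in> M. \<exists>C. P K C}" using V_subset[OF S(1)] by blast
  qed simp
  then have "\<exists>C. P K C" if "K \<in> M" for K using that by blast
  moreover have "P K C'" if "P K C" "C \<le> C'" for K C C'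
    using that energy_nonneg unfolding P_def
    by (meson mult_right_mono order_trans real_sqrt_ge_zero)
  ultimately obtain C where "C \<ge> 0" "\<And>K. K \<in> M \<Longrightarrow> P K C"
    using finite_uniform_bound[OF finite_M, of P] by metis
  then show ?thesis using that[of C] unfolding P_def by blast
qed

text \<open>Only an inequality is assumed for the tested equation, because Poisson residuals may
  survive on the faces of the box. \<open>C\<close> depends on \<open>g\<close> only through
  \<open>g\<^sub>0\<close>, so it applies whatever the concentrations are.\<close>

lemma poisson_bound:
  assumes MD: "MD \<subseteq> M" "MD \<noteq> {}" and lam: "lam > (0::real)"
  obtains C where "C \<ge> 0"
    and "\<And>v g K. \<forall>L\<in>MD. v L = 0 \<Longrightarrow> \<forall>L\<in>M. \<bar>g L\<bar> \<le> g\<^sub>0 \<Longrightarrow>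
      (\<Sum>K\<in>M. v K * (lam * (\<Sum>S\<in>star K. \<Sum>L\<in>V S. stiff S K L * ((h K + v K) - (h L + v L))) - g K)) \<le> 0 \<Longrightarrow>
      K \<in> M \<Longrightarrow> \<bar>v K\<bar> \<le> C"
proof -
  obtain C where C: "C \<ge> 0"
    "\<And>v K. \<forall>L\<in>MD. v L = 0 \<Longrightarrow> K \<in> M \<Longrightarrow> \<bar>v K\<bar> \<le> C * sqrt (energy v)"
    using discrete_poincare[OF MD] by blast
  define A where "A = (\<Sum>S\<in>\<T>. sqrt (vol S) * norm (dgrad S h))"
  have A: "A \<ge> 0" unfolding A_def by (auto intro!: sum_nonneg mult_nonneg_nonneg less_imp_le[OF vol_pos])
  \<comment> \<open>Testing gives \<open>s * s \<le> s * B\<close> for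
    \<open>s = sqrt (energy v)\<close>: \<open>A\<close> comes from the gradient of \<open>h\<close>
    by Cauchy-Schwarz, the other term from the right-hand side by
    \<open>discrete_poincare\<close>.\<close>
  define B where "B = A + real (card M) * \<bar>g\<^sub>0\<bar> * C / lam"
  have B: "B \<ge> 0" using A C lam by (simp add: B_def)
  show ?thesis
  proof (rule that[of "C * B"])
    show "C * B \<ge> 0" using C B by simp
    fix v g K
    assume v: "\<forall>L\<in>MD. v L = (0::real)" and g: "\<forall>L\<in>M. \<bar>g L\<bar> \<le> g\<^sub>0" and K: "K \<in> M"
    assume le: "(\<Sum>K\<in>M. v K * (lam * (\<Sum>S\<in>star K. \<Sum>L\<in>V S. stiff S K L * ((h K + v K) - (h L + v L))) - g K)) \<le> 0"
    define s where "s = sqrt (energy v)"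
    have s: "s \<ge> 0" by (simp add: s_def energy_nonneg)
    have "(\<Sum>K\<in>M. v K * (lam * (\<Sum>S\<in>star K. \<Sum>L\<in>V S. stiff S K L * ((h K + v K) - (h L + v L))) - g K)) =
        lam * (\<Sum>K\<in>M. v K * (\<Sum>S\<in>star K. 1 * (\<Sum>L\<in>V S. stiff S K L * ((h K + v K) - (h L + v L))))) - (\<Sum>K\<in>M. v K * g K)"
      by (simp add: right_diff_distrib sum_subtractf sum_distrib_left mult_ac)
    also have "\<dots> = lam * (\<Sum>S\<in>\<T>. vol S * (dgrad S v \<bullet> dgrad S h) + vol S * (norm (dgrad S v))\<^sup>2) - (\<Sum>K\<in>M. v K * g K)"
      by (simp only: summation_by_parts dgrad_add)
        (simp add: inner_add_right distrib_left power2_norm_eq_inner)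
    finally have 1: "lam * ((\<Sum>S\<in>\<T>. vol S * (dgrad S v \<bullet> dgrad S h)) + s\<^sup>2) \<le> (\<Sum>K\<in>M. v K * g K)"
      using le by (simp add: sum.distrib energy_def[symmetric] s_def energy_nonneg)
    have "(\<Sum>K\<in>M. v K * g K) \<le> (\<Sum>K\<in>M. (C * s) * \<bar>g\<^sub>0\<bar>)"
    proof (intro sum_mono)
      fix K assume K: "K \<in> M"
      have "\<bar>v K * g K\<bar> \<le> (C * s) * \<bar>g\<^sub>0\<bar>"
        unfolding abs_mult using C(2)[OF v K] g K s C(1)
        by (intro mult_mono) (auto simp: s_def intro: order_trans[OF _ abs_ge_self])
      then show "v K * g K \<le> (C * s) * \<bar>g\<^sub>0\<bar>" by linarith
    qed
    then have 2: "(\<Sum>K\<in>M. v K * g K) \<le> real (card M) * \<bar>g\<^sub>0\<bar> * C * s" by (simp add: mult_ac)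
    have "- (\<Sum>S\<in>\<T>. vol S * (dgrad S v \<bullet> dgrad S h)) \<le> (\<Sum>S\<in>\<T>. s * (sqrt (vol S) * norm (dgrad S h)))"
      unfolding sum_negf[symmetric]
    proof (intro sum_mono)
      fix S assume S: "S \<in> \<T>"
      have "- (vol S * (dgrad S v \<bullet> dgrad S h)) = vol S * (- (dgrad S v \<bullet> dgrad S h))" by simp
      also have "\<dots> \<le> vol S * (norm (dgrad S v) * norm (dgrad S h))"
        using Cauchy_Schwarz_ineq2[of "dgrad S v" "dgrad S h"] vol_pos[OF S] by (intro mult_left_mono) auto
      also have "\<dots> = (sqrt (vol S) * norm (dgrad S v)) * (sqrt (vol S) * norm (dgrad S h))"
        using vol_pos[OF S] by (simp add: algebra_simps)
      also have "\<dots> \<le> s * (sqrt (vol S) * norm (dgrad S h))"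
        using norm_dgrad_le[OF S, of v] vol_pos[OF S] by (intro mult_right_mono) (auto simp: s_def)
      finally show "- (vol S * (dgrad S v \<bullet> dgrad S h)) \<le> s * (sqrt (vol S) * norm (dgrad S h))" .
    qed
    then have 3: "- (\<Sum>S\<in>\<T>. vol S * (dgrad S v \<bullet> dgrad S h)) \<le> s * A"
      by (simp add: A_def sum_distrib_left)
    have "lam * s\<^sup>2 \<le> lam * (s * A) + real (card M) * \<bar>g\<^sub>0\<bar> * C * s"
      using 1 2 mult_left_mono[OF 3, of lam] lam by (simp add: algebra_simps)
    also have "\<dots> = lam * (s * B)" using lam by (simp add: B_def algebra_simps)
    finally have "s * s \<le> s * B" using lam by (simp add: power2_eq_square)
    then have "s \<le> B" using s B by (cases "s = 0") auto
    then show "\<bar>v K\<bar> \<le> C * B"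
      using C(2)[OF v K] C(1) mult_left_mono[of s B C] by (simp add: s_def)
  qed
qed

end

section \<open>A priori bounds\<close>

text \<open>Maximum and average of nonnegative vertex values both dominate a fixed multiple
  \<open>\<kappa>\<close> of each value. Both choices enter the proof through this property and
  continuity, so they are treated at once.\<close>

locale cell_complex_mobility = cell_complex M \<T> V G vol c\<^sub>0
  for M :: "'v set" and \<T> :: "'s set" and V :: "'s \<Rightarrow> 'v set"
    and G :: "'s \<Rightarrow> 'v \<Rightarrow> 'e::real_inner" and vol c\<^sub>0 +
  fixes mbl :: "('v \<Rightarrow> real) \<Rightarrow> 's \<Rightarrow> real" and \<kappa> :: real
  assumes \<kappa>_pos: "\<kappa> > 0"
    and mbl_ge: "S \<in> \<T> \<Longrightarrow> K \<in> V S \<Longrightarrow> (\<And>L. L \<in> V S \<Longrightarrow> w L \<ge> 0) \<Longrightarrow> \<kappa> * w K \<le> mbl w S"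
    and mbl_continuous: "S \<in> \<T> \<Longrightarrow> (\<And>K. K \<in> V S \<Longrightarrow> continuous_on UNIV (\<lambda>x. f x K)) \<Longrightarrow>
      continuous_on UNIV (\<lambda>x :: nat \<times> 'v \<Rightarrow> real. mbl (f x) S)"
begin

text \<open>The estimates whose constants do not see the box size. Dissipation is recorded per
  species and cell, because each propagation step uses one species on one cell.\<close>

definition bounded_state ::
  "nat \<Rightarrow> (nat \<Rightarrow> real) \<Rightarrow> (nat \<Rightarrow> real) \<Rightarrow> real \<Rightarrow> real \<Rightarrow> real \<Rightarrow>
   (nat \<Rightarrow> 'v \<Rightarrow> real) \<Rightarrow> ('v \<Rightarrow> real) \<Rightarrow> bool" where
  "bounded_state n D z \<beta> P E \<mu> \<phi> \<longleftrightarrow>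
     (\<forall>K\<in>M. \<bar>\<phi> K\<bar> \<le> P) \<and>
     (\<forall>i\<in>{1..n}. \<forall>S\<in>\<T>. mbl (softmax n \<mu> 0) S * mbl (softmax n \<mu> i) S *
        (D i * (vol S * (norm (dgrad S (\<lambda>K. \<mu> i K + \<beta> * z i * \<phi> K)))\<^sup>2)) \<le> E)"

lemma mbl_softmax_ge:
  "S \<in> \<T> \<Longrightarrow> K \<in> V S \<Longrightarrow> \<kappa> * softmax n \<mu> i K \<le> mbl (softmax n \<mu> i) S"
  by (rule mbl_ge) (auto intro: less_imp_le[OF softmax_pos])

lemma mbl_softmax_nonneg: "S \<in> \<T> \<Longrightarrow> V S \<noteq> {} \<Longrightarrow> mbl (softmax n \<mu> i) S \<ge> 0"
  using mbl_softmax_ge[of S _ n \<mu> i] \<kappa>_pos softmax_pos[of n \<mu> i]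
  by (meson all_not_in_conv less_imp_le mult_pos_pos order_trans)

text \<open>If the solvent and species \<open>i\<close> are non-negligible somewhere on
  \<open>S\<close>, possibly at different vertices, both cell mobilities are bounded below, and the
  dissipation controls the gradient of the electrochemical potential. The bound \<open>P\<close>
  then removes the electric part.\<close>

lemma edge_bound:
  assumes i: "i \<in> {1..n}" and D: "D i > 0" and S: "S \<in> \<T>"
  obtains X where "X \<ge> 0" and
    "\<And>\<mu> \<phi> K L K' K''. bounded_state n D z \<beta> P E \<mu> \<phi> \<Longrightarrow> K \<in> V S \<Longrightarrow> L \<in> V S \<Longrightarrow>
      K' \<in> V S \<Longrightarrow> softmax n \<mu> 0 K' \<ge> exp (- C) \<Longrightarrow>
      K'' \<in> V S \<Longrightarrow> softmax n \<mu> i K'' \<ge> exp (- C) \<Longrightarrow> \<bar>\<mu> i K - \<mu> i L\<bar> \<le> X"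
proof -
  define q where "q = (\<kappa> * exp (- C)) * (\<kappa> * exp (- C)) * (D i * vol S)"
  have q: "q > 0" using \<kappa>_pos D vol_pos[OF S] by (simp add: q_def)
  define X where "X = c\<^sub>0 * sqrt (E / q) + 2 * (\<bar>\<beta> * z i\<bar> * P)"
  have bnd: "\<bar>\<mu> i K - \<mu> i L\<bar> \<le> X"
    if bs: "bounded_state n D z \<beta> P E \<mu> \<phi>" and K: "K \<in> V S" and L: "L \<in> V S"
      and K': "K' \<in> V S" "softmax n \<mu> 0 K' \<ge> exp (- C)"
      and K'': "K'' \<in> V S" "softmax n \<mu> i K'' \<ge> exp (- C)" for \<mu> \<phi> K L K' K''
  proof -
    define \<xi> where "\<xi> = (\<lambda>K. \<mu> i K + \<beta> * z i * \<phi> K)"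
    have "\<kappa> * exp (- C) \<le> mbl (softmax n \<mu> 0) S"
      using mbl_softmax_ge[OF S K'(1), of n \<mu> 0] mult_left_mono[OF K'(2), of \<kappa>] \<kappa>_pos by linarith
    moreover have "\<kappa> * exp (- C) \<le> mbl (softmax n \<mu> i) S"
      using mbl_softmax_ge[OF S K''(1), of n \<mu> i] mult_left_mono[OF K''(2), of \<kappa>] \<kappa>_pos by linarith
    ultimately have "(\<kappa> * exp (- C)) * (\<kappa> * exp (- C)) \<le> mbl (softmax n \<mu> 0) S * mbl (softmax n \<mu> i) S"
      using \<kappa>_pos mult_pos_pos[OF \<kappa>_pos exp_gt_zero[of "- C"]] by (intro mult_mono) linarith+
    then have "q * (norm (dgrad S \<xi>))\<^sup>2 \<le> mbl (softmax n \<mu> 0) S * mbl (softmax n \<mu> i) S *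
        (D i * (vol S * (norm (dgrad S \<xi>))\<^sup>2))"
      unfolding q_def mult.assoc[of _ "D i * vol S"] mult.assoc[of "D i"]
      using D vol_pos[OF S] by (intro mult_right_mono) auto
    also have "\<dots> \<le> E" using bs i S by (simp add: bounded_state_def \<xi>_def)
    finally have "(norm (dgrad S \<xi>))\<^sup>2 \<le> E / q" using q by (simp add: field_simps)
    then have "norm (dgrad S \<xi>) \<le> sqrt (E / q)" by (rule real_le_rsqrt)
    then have "\<bar>\<xi> K - \<xi> L\<bar> \<le> c\<^sub>0 * sqrt (E / q)"
      using diff_le[OF S K L, of \<xi>] mult_left_mono[of "norm (dgrad S \<xi>)" "sqrt (E / q)" c\<^sub>0] c0_pos
      unfolding dgrad_def by linarith
    moreover have "\<bar>\<beta> * z i * \<phi> J\<bar> \<le> \<bar>\<beta> * z i\<bar> * P" if "J \<in> V S" for J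
      unfolding abs_mult[of _ "\<phi> J"] using bs that V_subset[OF S]
      by (intro mult_left_mono) (auto simp: bounded_state_def)
    from this[OF K] this[OF L]
    have "\<bar>\<beta> * z i * \<phi> K\<bar> \<le> \<bar>\<beta> * z i\<bar> * P" "\<bar>\<beta> * z i * \<phi> L\<bar> \<le> \<bar>\<beta> * z i\<bar> * P" by auto
    ultimately show ?thesis unfolding X_def \<xi>_def by linarith
  qed
  show ?thesis
    by (rule that[of "\<bar>X\<bar>"]) (use bnd in \<open>force intro: order_trans[OF _ abs_ge_self]\<close>)+
qed

text \<open>The solvent comes first because every mobility product contains its factor. It is rare
  at a vertex only if some \<open>\<mu> j\<close> is large there, and the species with the largest
  potential is then abundant at that vertex; with solvent at a neighbour, \<open>edge_bound\<close>
  applies to it.\<close>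

lemma solvent_bound:
  assumes D: "\<And>i. i \<in> {1..n} \<Longrightarrow> D i > 0" and \<eta>: "\<eta> > 0"
  obtains C where "C \<ge> 0" and
    "\<And>\<mu> \<phi> K\<^sub>0 K. bounded_state n D z \<beta> P E \<mu> \<phi> \<Longrightarrow> K\<^sub>0 \<in> M \<Longrightarrow> softmax n \<mu> 0 K\<^sub>0 \<ge> \<eta> \<Longrightarrow>
      K \<in> M \<Longrightarrow> softmax n \<mu> 0 K \<ge> exp (- C)"
proof -
  define Q where "Q K\<^sub>0 K C \<longleftrightarrow> (\<forall>\<mu> \<phi>. bounded_state n D z \<beta> P E \<mu> \<phi> \<longrightarrow> softmax n \<mu> 0 K\<^sub>0 \<ge> \<eta> \<longrightarrow>
      softmax n \<mu> 0 K \<ge> exp (- C))" for K\<^sub>0 K C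
  have mono: "Q K\<^sub>0 K C'" if "Q K\<^sub>0 K C" "C \<le> C'" for K\<^sub>0 K C C'
    using that unfolding Q_def by (meson exp_le_cancel_iff neg_le_iff_le order_trans)
  have "{K \<in> M. \<exists>C. Q K\<^sub>0 K C} = M" if K0: "K\<^sub>0 \<in> M" for K\<^sub>0
  proof (rule connected)
    have "Q K\<^sub>0 K\<^sub>0 (- ln \<eta>)" using \<eta> by (simp add: Q_def)
    then show "{K \<in> M. \<exists>C. Q K\<^sub>0 K C} \<noteq> {}" using K0 by blast
    fix S assume S: "S \<in> \<T>" "V S \<inter> {K \<in> M. \<exists>C. Q K\<^sub>0 K C} \<noteq> {}"
    then obtain K C where K: "K \<in> V S" and QK: "Q K\<^sub>0 K C" by blast
    \<comment> \<open>One threshold for both inputs of \<open>edge_bound\<close>: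
      \<open>exp (- C)\<close> for the solvent at \<open>K\<close>, and
      \<open>1 / (1 + real n)\<close> for the species of largest potential at \<open>L\<close>,
      which has at least this concentration if that potential is positive.\<close>
    define C1 where "C1 = max C (ln (1 + real n))"
    have "exp (- C1) \<le> exp (- ln (1 + real n))" by (simp add: C1_def)
    also have "\<dots> = 1 / (1 + real n)" by (simp add: exp_minus inverse_eq_divide)
    finally have C1: "exp (- C1) \<le> exp (- C)" "exp (- C1) \<le> 1 / (1 + real n)"
      by (simp_all add: C1_def)
    define R where "R i X \<longleftrightarrow> (\<forall>\<mu> \<phi> K L K' K''. bounded_state n D z \<beta> P E \<mu> \<phi> \<longrightarrow> K \<in> V S \<longrightarrow> L \<in> V S \<longrightarrow>
      K' \<in> V S \<longrightarrow> softmax n \<mu> 0 K' \<ge> exp (- C1) \<longrightarrow>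
      K'' \<in> V S \<longrightarrow> softmax n \<mu> i K'' \<ge> exp (- C1) \<longrightarrow> \<bar>\<mu> i K - \<mu> i L\<bar> \<le> X)" for i X
    have "\<exists>X. R i X" if "i \<in> {1..n}" for i
      using edge_bound[where i=i and D=D and z=z and \<beta>=\<beta> and P=P and E=E and C=C1, OF that D[OF that] S(1)] unfolding R_def by metis
    moreover have "R i X'" if "R i X" "X \<le> X'" for i X X'
      using that unfolding R_def by (meson order_trans)
    ultimately obtain X where X: "X \<ge> 0" "\<And>i. i \<in> {1..n} \<Longrightarrow> R i X"
      by (rule finite_uniform_bound[of "{1..n}" R, rotated]) auto
    \<comment> \<open>The solvent bound at \<open>K\<close> gives \<open>\<mu> j K \<le> C\<close>,
      and crossing the cell adds at most \<open>X\<close>; the maximum with 0 covers the case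
      \<open>\<mu> j L \<le> 0\<close>.\<close>
    define Y where "Y = max 0 (C + X)"
    have "Q K\<^sub>0 L (ln (1 + real n * exp Y))" if L: "L \<in> V S" for L
      unfolding Q_def
    proof (intro allI impI)
      fix \<mu> \<phi> assume bs: "bounded_state n D z \<beta> P E \<mu> \<phi>" and "softmax n \<mu> 0 K\<^sub>0 \<ge> \<eta>"
      then have uK: "softmax n \<mu> 0 K \<ge> exp (- C)" using QK unfolding Q_def by blast
      have "\<mu> i L \<le> Y" if i: "i \<in> {1..n}" for i
      proof -
        have "Max ((\<lambda>i. \<mu> i L) ` {1..n}) \<in> (\<lambda>i. \<mu> i L) ` {1..n}" using i by (intro Max_in) auto
        then obtain j where j: "j \<in> {1..n}" "Max ((\<lambda>i. \<mu> i L) ` {1..n}) = \<mu> j L" by auto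
        have jmax: "\<mu> k L \<le> \<mu> j L" if "k \<in> {1..n}" for k
          using Max_ge[of "(\<lambda>i. \<mu> i L) ` {1..n}" "\<mu> k L"] that
          unfolding j(2) by blast
        \<comment> \<open>If \<open>\<mu> j L > 0\<close> is the largest potential at \<open>L\<close>, then species \<open>j\<close> is not rare there, so its
          mobility on \<open>S\<close> is bounded below and the dissipation controls \<open>\<mu> j K - \<mu> j L\<close>.\<close>
        have "\<mu> j L \<le> Y"
        proof (cases "\<mu> j L \<le> 0")
          case True then show ?thesis by (simp add: Y_def)
        next
          case False
          have "(\<Sum>k=1..n. exp (\<mu> k L)) \<le> (\<Sum>k=1..n. exp (\<mu> j L))"
            by (intro sum_mono) (simp add: jmax)
          then have "1 + (\<Sum>k=1..n. exp (\<mu> k L)) \<le> (1 + real n) * exp (\<mu> j L)"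
            using False by (simp add: algebra_simps)
              (smt (verit) one_le_exp_iff)
          then have "1 / (1 + real n) \<le> softmax n \<mu> j L"
            using softmax_denom_pos[of \<mu> L n] j(1) by (simp add: softmax_def field_simps)
          then have "exp (- C1) \<le> softmax n \<mu> j L" using C1(2) by linarith
          then have "\<bar>\<mu> j K - \<mu> j L\<bar> \<le> X"
            using X(2)[OF j(1)] bs K L uK C1(1) unfolding R_def by (meson order_trans)
          moreover have "\<mu> j K \<le> C"
          proof -
            have "exp (- C) * exp (\<mu> j K) \<le> softmax n \<mu> 0 K * exp (\<mu> j K)"
              using uK by (intro mult_right_mono) auto
            also have "\<dots> = softmax n \<mu> j K" using j(1) by (simp add: softmax_exp[of j])
            also have "\<dots> \<le> 1" using j(1) by (intro softmax_le_1) auto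
            finally show ?thesis by (simp add: exp_add[symmetric])
          qed
          ultimately show ?thesis by (simp add: Y_def)
        qed
        then show ?thesis using jmax[OF i] by linarith
      qed
      then have "(\<Sum>i=1..n. exp (\<mu> i L)) \<le> (\<Sum>i=1..n. exp Y)"
        by (intro sum_mono) simp
      then have "1 + (\<Sum>i=1..n. exp (\<mu> i L)) \<le> 1 + real n * exp Y" by simp
      then show "exp (- ln (1 + real n * exp Y)) \<le> softmax n \<mu> 0 L"
        using softmax_denom_pos[of \<mu> L n]
        by (simp add: softmax_def exp_minus inverse_eq_divide add_pos_nonneg frac_le)
    qed
    then show "V S \<subseteq> {K \<in> M. \<exists>C. Q K\<^sub>0 K C}" using V_subset[OF S(1)] by blast
  qed simp
  \<comment> \<open>Pairs make the constant uniform in the starting vertex too, since the vertex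
    where the solvent is abundant depends on the state.\<close>
  then have "\<exists>C. Q (fst p) (snd p) C" if "p \<in> M \<times> M" for p using that by fastforce
  then obtain C where "C \<ge> 0" "\<And>p. p \<in> M \<times> M \<Longrightarrow> Q (fst p) (snd p) C"
    by (rule finite_uniform_bound[of "M \<times> M" "\<lambda>p. Q (fst p) (snd p)", rotated])
      (use finite_M in \<open>auto intro: mono\<close>)
  then show ?thesis using that[of C] unfolding Q_def by force
qed

text \<open>With the solvent bounded below everywhere, lower bounds on \<open>\<mu> i\<close> and on
  the concentration of species \<open>i\<close> are equivalent up to constants; the latter keeps the
  mobility of the next cell non-degenerate, and \<open>edge_bound\<close> carries the former
  across.\<close>

lemma species_bound:
  assumes i: "i \<in> {1..n}" and D: "D i > 0" and \<eta>: "\<eta> > 0"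
  obtains C where "C \<ge> 0" and
    "\<And>\<mu> \<phi> K\<^sub>0 K. bounded_state n D z \<beta> P E \<mu> \<phi> \<Longrightarrow> K\<^sub>0 \<in> M \<Longrightarrow> softmax n \<mu> i K\<^sub>0 \<ge> \<eta> \<Longrightarrow>
      \<forall>L\<in>M. softmax n \<mu> 0 L \<ge> exp (- C\<^sub>1) \<Longrightarrow> K \<in> M \<Longrightarrow> \<mu> i K \<ge> - C"
proof -
  define Q where "Q K\<^sub>0 K C \<longleftrightarrow> (\<forall>\<mu> \<phi>. bounded_state n D z \<beta> P E \<mu> \<phi> \<longrightarrow> softmax n \<mu> i K\<^sub>0 \<ge> \<eta> \<longrightarrow>
      (\<forall>L\<in>M. softmax n \<mu> 0 L \<ge> exp (- C\<^sub>1)) \<longrightarrow> \<mu> i K \<ge> - C)" for K\<^sub>0 K C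
  have mono: "Q K\<^sub>0 K C'" if "Q K\<^sub>0 K C" "C \<le> C'" for K\<^sub>0 K C C'
    using that unfolding Q_def by (meson neg_le_iff_le order_trans)
  have "{K \<in> M. \<exists>C. Q K\<^sub>0 K C} = M" if K0: "K\<^sub>0 \<in> M" for K\<^sub>0
  proof (rule connected)
    have "Q K\<^sub>0 K\<^sub>0 (- ln \<eta>)"
      unfolding Q_def
    proof (intro allI impI)
      fix \<mu> assume "softmax n \<mu> i K\<^sub>0 \<ge> \<eta>"
      moreover have "softmax n \<mu> i K\<^sub>0 \<le> exp (\<mu> i K\<^sub>0)"
        using softmax_le_1[of 0 n \<mu> K\<^sub>0] i by (simp add: softmax_exp[of i])
      ultimately have "ln \<eta> \<le> ln (exp (\<mu> i K\<^sub>0))" using \<eta> by (subst ln_le_cancel_iff) auto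
      then show "- (- ln \<eta>) \<le> \<mu> i K\<^sub>0" by simp
    qed
    then show "{K \<in> M. \<exists>C. Q K\<^sub>0 K C} \<noteq> {}" using K0 by blast
    fix S assume S: "S \<in> \<T>" "V S \<inter> {K \<in> M. \<exists>C. Q K\<^sub>0 K C} \<noteq> {}"
    then obtain K C where K: "K \<in> V S" and QK: "Q K\<^sub>0 K C" by blast
    \<comment> \<open>\<open>exp (- (C\<^sub>1 + C))\<close> bounds
      \<open>softmax n \<mu> 0 K * exp (\<mu> i K)\<close> from below; the maximum covers negative
      \<open>C\<close>.\<close>
    define C2 where "C2 = max C\<^sub>1 (C\<^sub>1 + C)"
    obtain X where X: "X \<ge> 0" 
      "\<And>\<mu> \<phi> K L K' K''. bounded_state n D z \<beta> P E \<mu> \<phi> \<Longrightarrow> K \<in> V S \<Longrightarrow> L \<in> V S \<Longrightarrow>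
      K' \<in> V S \<Longrightarrow> softmax n \<mu> 0 K' \<ge> exp (- C2) \<Longrightarrow>
      K'' \<in> V S \<Longrightarrow> softmax n \<mu> i K'' \<ge> exp (- C2) \<Longrightarrow> \<bar>\<mu> i K - \<mu> i L\<bar> \<le> X"
      using edge_bound[where i=i and D=D and z=z and \<beta>=\<beta> and P=P and E=E and C=C2, OF i D S(1)] by blast
    have "Q K\<^sub>0 L (C + X)" if L: "L \<in> V S" for L
      unfolding Q_def
    proof (intro allI impI)
      fix \<mu> \<phi> assume bs: "bounded_state n D z \<beta> P E \<mu> \<phi>" and "softmax n \<mu> i K\<^sub>0 \<ge> \<eta>"
        and u0: "\<forall>L\<in>M. softmax n \<mu> 0 L \<ge> exp (- C\<^sub>1)"
      then have \<mu>K: "\<mu> i K \<ge> - C" using QK unfolding Q_def by blast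
      have u0K: "softmax n \<mu> 0 K \<ge> exp (- C\<^sub>1)" using u0 K V_subset[OF S(1)] by blast
      have "exp (- C\<^sub>1) * exp (- C) \<le> softmax n \<mu> 0 K * exp (\<mu> i K)"
        using u0K \<mu>K softmax_pos[of n \<mu> 0 K] by (intro mult_mono) auto
      then have "exp (- (C\<^sub>1 + C)) \<le> softmax n \<mu> i K"
        using i by (simp add: softmax_exp[of i] exp_add[symmetric])
      moreover have "exp (- C2) \<le> exp (- (C\<^sub>1 + C))" "exp (- C2) \<le> exp (- C\<^sub>1)"
        by (auto simp: C2_def)
      ultimately have "\<bar>\<mu> i K - \<mu> i L\<bar> \<le> X"
        using u0K by (intro X(2)[OF bs K L K _ K]) linarith+
      then show "- (C + X) \<le> \<mu> i L" using \<mu>K by linarith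
    qed
    then show "V S \<subseteq> {K \<in> M. \<exists>C. Q K\<^sub>0 K C}" using V_subset[OF S(1)] by blast
  qed simp
  then have "\<exists>C. Q (fst p) (snd p) C" if "p \<in> M \<times> M" for p using that by fastforce
  then obtain C where "C \<ge> 0" "\<And>p. p \<in> M \<times> M \<Longrightarrow> Q (fst p) (snd p) C"
    by (rule finite_uniform_bound[of "M \<times> M" "\<lambda>p. Q (fst p) (snd p)", rotated])
      (use finite_M in \<open>auto intro: mono\<close>)
  then show ?thesis using that[of C] unfolding Q_def by force
qed

text \<open>Upper bounds come from \<open>softmax n \<mu> 0 K * exp (\<mu> i K) \<le> 1\<close>,
  lower ones from \<open>species_bound\<close>. One good vertex per species is asked for, which is
  what a lower bound on the total mass can give.\<close>

lemma potential_bound: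
  assumes D: "\<And>i. i \<in> {1..n} \<Longrightarrow> D i > 0" and \<eta>: "\<eta> > 0"
  obtains C where "C \<ge> 0" and
    "\<And>\<mu> \<phi> i K. bounded_state n D z \<beta> P E \<mu> \<phi> \<Longrightarrow> \<forall>j\<in>{0..n}. \<exists>K\<in>M. softmax n \<mu> j K \<ge> \<eta> \<Longrightarrow>
      i \<in> {1..n} \<Longrightarrow> K \<in> M \<Longrightarrow> \<bar>\<mu> i K\<bar> \<le> C"
proof -
  obtain C0 where C0: "C0 \<ge> 0"
    "\<And>\<mu> \<phi> K\<^sub>0 K. bounded_state n D z \<beta> P E \<mu> \<phi> \<Longrightarrow> K\<^sub>0 \<in> M \<Longrightarrow> softmax n \<mu> 0 K\<^sub>0 \<ge> \<eta> \<Longrightarrow>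
      K \<in> M \<Longrightarrow> softmax n \<mu> 0 K \<ge> exp (- C0)"
    by (rule solvent_bound[of n D \<eta> z \<beta> P E]) (use D \<eta> in auto)
  define Q where "Q i C \<longleftrightarrow> (\<forall>\<mu> \<phi> K\<^sub>0 K. bounded_state n D z \<beta> P E \<mu> \<phi> \<longrightarrow> K\<^sub>0 \<in> M \<longrightarrow> softmax n \<mu> i K\<^sub>0 \<ge> \<eta> \<longrightarrow>
      (\<forall>L\<in>M. softmax n \<mu> 0 L \<ge> exp (- C0)) \<longrightarrow> K \<in> M \<longrightarrow> \<mu> i K \<ge> - C)" for i C
  have "\<exists>C. Q i C" if "i \<in> {1..n}" for i
    using species_bound[where i=i and D=D and \<eta>=\<eta> and z=z and \<beta>=\<beta> and P=P and E=E and C\<^sub>1=C0, OF that D[OF that] \<eta>] unfolding Q_def by metis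
  moreover have "Q i C'" if "Q i C" "C \<le> C'" for i C C'
    using that unfolding Q_def by (meson neg_le_iff_le order_trans)
  ultimately obtain C1 where C1: "C1 \<ge> 0" "\<And>i. i \<in> {1..n} \<Longrightarrow> Q i C1"
    by (rule finite_uniform_bound[of "{1..n}" Q, rotated]) auto
  show ?thesis
  proof (rule that[of "C0 + C1"])
    show "C0 + C1 \<ge> 0" using C0 C1 by simp
    fix \<mu> \<phi> i K
    assume bs: "bounded_state n D z \<beta> P E \<mu> \<phi>" and ex: "\<forall>j\<in>{0..n}. \<exists>K\<in>M. softmax n \<mu> j K \<ge> \<eta>"
      and i: "i \<in> {1..n}" and K: "K \<in> M"
    have u0: "\<forall>L\<in>M. softmax n \<mu> 0 L \<ge> exp (- C0)" using ex C0(2)[OF bs] by (meson atLeastAtMost_iff le0)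
    have "\<mu> i K \<ge> - C1"
      using C1(2)[OF i] bs ex i u0 K unfolding Q_def by (metis atLeastAtMost_iff le0)
    moreover have "\<mu> i K \<le> C0"
    proof -
      have "exp (- C0) * exp (\<mu> i K) \<le> softmax n \<mu> 0 K * exp (\<mu> i K)"
        using u0 K by (intro mult_right_mono) auto
      also have "\<dots> = softmax n \<mu> i K" using i by (simp add: softmax_exp[of i])
      also have "\<dots> \<le> 1" using i by (intro softmax_le_1) auto
      finally show ?thesis by (simp add: exp_add[symmetric])
    qed
    ultimately show "\<bar>\<mu> i K\<bar> \<le> C0 + C1" using C0 C1 by linarith
  qed
qed

end

section \<open>One time step\<close>

context cell_complex_mobility
begin

lemma exists_ge_average:
  assumes "M \<noteq> {}" and m: "\<And>K. K \<in> M \<Longrightarrow> m K > 0" and "(\<Sum>K\<in>M. m K * v K) \<ge> c * (\<Sum>K\<in>M. m K)"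
  shows "\<exists>K\<in>M. v K \<ge> (c::real)"
proof (rule ccontr)
  assume "\<not> ?thesis"
  then have "(\<Sum>K\<in>M. m K * v K) < (\<Sum>K\<in>M. m K * c)"
    using assms(1) finite_M m by (intro sum_strict_mono) (auto simp: not_le)
  then show False using assms(3) by (simp add: sum_distrib_left mult.commute)
qed

text \<open>\<open>v\<close> stands for the previous concentrations, \<open>m\<close> for the dual
  volumes, \<open>h\<close> for the Dirichlet lifting, \<open>g\<close> for the integrated source
  and \<open>lam\<close> for the squared coefficient of the Poisson equation.\<close>

theorem time_step_solution:
  fixes m g h :: "'v \<Rightarrow> real" and v :: "nat \<Rightarrow> 'v \<Rightarrow> real" and z D :: "nat \<Rightarrow> real"
  assumes MD: "MD \<subseteq> M" "MD \<noteq> {}" and lam: "lam > (0::real)" and \<tau>: "\<tau> > (0::real)"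
    and D: "\<And>i. i \<in> {1..n} \<Longrightarrow> D i > 0" and m: "\<And>K. K \<in> M \<Longrightarrow> m K > 0"
    and v_nonneg: "\<And>i K. i \<in> {1..n} \<Longrightarrow> K \<in> M \<Longrightarrow> v i K \<ge> 0"
    and v_sum: "\<And>K. K \<in> M \<Longrightarrow> (\<Sum>i=1..n. v i K) \<le> 1"
    and mass: "\<And>i. i \<in> {1..n} \<Longrightarrow> (\<Sum>K\<in>M. m K * v i K) > 0"
    and mass0: "(\<Sum>K\<in>M. m K * (1 - (\<Sum>i=1..n. v i K))) > 0"
  obtains \<mu> \<phi> where
    "\<And>i K. i \<in> {1..n} \<Longrightarrow> K \<in> M \<Longrightarrow> m K * ((softmax n \<mu> i K - v i K) / \<tau>) +
       (\<Sum>S\<in>star K. \<Sum>L\<in>V S. mbl (softmax n \<mu> 0) S * mbl (softmax n \<mu> i) S *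
          (D i * stiff S K L * ((\<mu> i K - \<mu> i L) + \<beta> * z i * (\<phi> K - \<phi> L)))) = 0"
    and "\<And>K. K \<in> MD \<Longrightarrow> \<phi> K = h K"
    and "\<And>K. K \<in> M - MD \<Longrightarrow> lam * (\<Sum>S\<in>star K. \<Sum>L\<in>V S. stiff S K L * (\<phi> K - \<phi> L)) =
       m K * (\<Sum>i=1..n. z i * softmax n \<mu> i K) + g K"
proof -
  have M_ne: "M \<noteq> {}" using MD by auto
  define Z where "Z = (\<Sum>i=1..n. \<bar>z i\<bar>)"
  have Z0: "Z \<ge> 0" by (simp add: Z_def sum_nonneg)
  define rhs where "rhs \<mu> K = m K * (\<Sum>i=1..n. z i * softmax n \<mu> i K) + g K" for \<mu> K
  define g\<^sub>0 where "g\<^sub>0 = (\<Sum>K\<in>M. m K * Z + \<bar>g K\<bar>)"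
  have rhs_le: "\<bar>rhs \<mu> K\<bar> \<le> g\<^sub>0" if "K \<in> M" for \<mu> K
  proof -
    have "\<bar>\<Sum>i=1..n. z i * softmax n \<mu> i K\<bar> \<le> (\<Sum>i=1..n. \<bar>z i\<bar> * 1)"
      by (rule order_trans[OF sum_abs], intro sum_mono)
        (auto simp: abs_mult abs_of_pos[OF softmax_pos] simp del: mult_1_right
          intro!: mult_left_mono softmax_le_1)
    then have "\<bar>m K * (\<Sum>i=1..n. z i * softmax n \<mu> i K)\<bar> \<le> m K * Z"
      using m[OF that] by (simp add: abs_mult Z_def)
    then have "\<bar>rhs \<mu> K\<bar> \<le> m K * Z + \<bar>g K\<bar>" unfolding rhs_def by linarith
    also have "\<dots> \<le> g\<^sub>0"
      unfolding g\<^sub>0_def using m Z0 finite_M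
      by (intro member_le_sum[OF that]) (auto intro!: add_nonneg_nonneg mult_nonneg_nonneg simp: less_imp_le)
    finally show ?thesis .
  qed
  obtain P0 where P0: "P0 \<ge> 0"
    "\<And>v g K. \<forall>L\<in>MD. v L = 0 \<Longrightarrow> \<forall>L\<in>M. \<bar>g L\<bar> \<le> g\<^sub>0 \<Longrightarrow>
      (\<Sum>K\<in>M. v K * (lam * (\<Sum>S\<in>star K. \<Sum>L\<in>V S. stiff S K L * ((h K + v K) - (h L + v L))) - g K)) \<le> 0 \<Longrightarrow>
      K \<in> M \<Longrightarrow> \<bar>v K\<bar> \<le> P0"
    using poisson_bound[where h=h and g\<^sub>0=g\<^sub>0, OF MD lam] by blast
  define P where "P = P0 + (\<Sum>K\<in>M. \<bar>h K\<bar>)"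
  have h_le: "\<bar>h K\<bar> \<le> (\<Sum>K\<in>M. \<bar>h K\<bar>)" if "K \<in> M" for K
    using member_le_sum[OF that, of "\<lambda>K. \<bar>h K\<bar>"] finite_M by simp
  have P: "P \<ge> 0" using P0 by (simp add: P_def sum_nonneg)
  define m\<^sub>1 where "m\<^sub>1 = (\<Sum>K\<in>M. m K)"
  have m1: "m\<^sub>1 > 0" unfolding m\<^sub>1_def using M_ne finite_M m by (intro sum_pos) auto
  \<comment> \<open>The lower bounds of \<open>lower\<close> summed with weights
    \<open>m K / \<tau>\<close>: \<open>n + 1\<close> from the entropy estimate,
    \<open>|\<beta>| * Z * P\<close> from the electric part of the test function.\<close>
  define E where "E = m\<^sub>1 / \<tau> * ((real n + 1) + \<bar>\<beta>\<bar> * Z * P)"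
  have E0: "E \<ge> 0" using m1 \<tau> Z0 P by (simp add: E_def)
  define mass_of where "mass_of j = (if j = 0 then \<Sum>K\<in>M. m K * (1 - (\<Sum>i=1..n. v i K))
      else \<Sum>K\<in>M. m K * v j K)" for j
  define c where "c = Min (mass_of ` {0..n})"
  have "c \<in> mass_of ` {0..n}" unfolding c_def by (intro Min_in) auto
  then have c: "c > 0" using mass mass0 by (auto simp: mass_of_def split: if_splits)
  have c_le: "c \<le> mass_of j" if "j \<in> {0..n}" for j unfolding c_def using that by (intro Min_le) auto
  \<comment> \<open>Half of the smallest mass spread over the total volume: a species that keeps
    half of its mass has at least this average, hence at least this value at some vertex.\<close>
  define \<eta> where "\<eta> = c / (2 * m\<^sub>1)"
  have \<eta>: "\<eta> > 0" using c m1 by (simp add: \<eta>_def)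
  obtain B0 where B0: "B0 \<ge> 0"
    "\<And>\<mu> \<phi> i K. bounded_state n D z \<beta> P E \<mu> \<phi> \<Longrightarrow> \<forall>j\<in>{0..n}. \<exists>K\<in>M. softmax n \<mu> j K \<ge> \<eta> \<Longrightarrow>
      i \<in> {1..n} \<Longrightarrow> K \<in> M \<Longrightarrow> \<bar>\<mu> i K\<bar> \<le> B0"
    by (rule potential_bound[of n D \<eta> z \<beta> P E]) (use D \<eta> in auto)
  \<comment> \<open>\<open>B0 + 1\<close> puts the a priori bound strictly inside the box,
    \<open>|\<beta>| * Z * P\<close> absorbs the electric part of the test function, and
    \<open>2 * \<tau> * E / c\<close> makes the residual cost each species at most half of its
    mass.\<close>
  define B where "B = B0 + 1 + \<bar>\<beta>\<bar> * Z * P + 2 * \<tau> * E / c"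
  have B: "B > B0" "B - \<bar>\<beta>\<bar> * Z * P \<ge> 1" "B - \<bar>\<beta>\<bar> * Z * P \<ge> 2 * \<tau> * E / c"
    using E0 \<tau> c B0 Z0 P by (auto simp: B_def intro!: add_pos_nonneg)

  \<comment> \<open>The coordinate \<open>(i, K)\<close> is the chemical potential of species \<open>i\<close> at \<open>K\<close> for \<open>i \<ge> 1\<close>, and the
    deviation of the electric potential from \<open>h\<close> at the free vertex \<open>K\<close> for \<open>i = 0\<close>.\<close>
  define mu where "mu x = (\<lambda>i K. x (i, K))" for x :: "nat \<times> 'v \<Rightarrow> real"
  define w where "w x K = (if K \<in> M - MD then x (0, K) else 0)" for x :: "nat \<times> 'v \<Rightarrow> real" and K
  define ph where "ph x = (\<lambda>K. h K + w x K)" for x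
  define Fs where "Fs x i K = m K * ((softmax n (mu x) i K - v i K) / \<tau>) +
       (\<Sum>S\<in>star K. \<Sum>L\<in>V S. mbl (softmax n (mu x) 0) S * mbl (softmax n (mu x) i) S *
          (D i * stiff S K L * ((mu x i K - mu x i L) + \<beta> * z i * (ph x K - ph x L))))" for x i K
  define Fp where "Fp x K = lam * (\<Sum>S\<in>star K. \<Sum>L\<in>V S. stiff S K L * (ph x K - ph x L)) - rhs (mu x) K" for x K
  define I where "I = {1..n} \<times> M \<union> {0} \<times> (M - MD)"
  define F where "F p x = (if fst p = 0 then Fp x (snd p) else Fs x (fst p) (snd p))" for p x
  \<comment> \<open>The extra 1 keeps the bound \<open>P0\<close> for the deviation off the face, so
    the Poisson residuals vanish for every \<open>B\<close>.\<close>
  define b where "b p = (if fst p = 0 then P0 + 1 else B)" for p :: "nat \<times> 'v"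
  have cont_mu: "continuous_on UNIV (\<lambda>x. mu x i K)" for i K by (simp add: mu_def)
  have cont_ph: "continuous_on UNIV (\<lambda>x. ph x K)" for K
    by (cases "K \<in> M - MD") (auto simp: ph_def w_def intro!: continuous_intros)
  have cont_sm: "continuous_on UNIV (\<lambda>x. softmax n (mu x) i K)" if "i \<le> n" for i K
    by (intro continuous_on_softmax cont_mu that)
  have cont_mbl: "continuous_on UNIV (\<lambda>x. mbl (softmax n (mu x) i) S)" if "i \<le> n" "S \<in> \<T>" for i S
    by (rule mbl_continuous[OF that(2)]) (rule cont_sm[OF that(1)])
  have contF: "continuous_on UNIV (F p)" if "p \<in> I" for p
  proof (cases "fst p = 0")
    case True
    then have "F p = (\<lambda>x. Fp x (snd p))" by (auto simp: F_def)
    then show ?thesis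
      unfolding Fp_def rhs_def by (auto intro!: continuous_intros cont_ph cont_sm)
  next
    case False
    then have "F p = (\<lambda>x. Fs x (fst p) (snd p))" "fst p \<le> n" using that by (auto simp: F_def I_def)
    then show ?thesis
      unfolding Fs_def using \<tau> by (auto simp: star_def intro!: continuous_intros cont_ph cont_mu cont_sm cont_mbl)
  qed
  have "finite I" using finite_M by (simp add: I_def)
  moreover have "b p > 0" for p using P0 B B0 by (auto simp: b_def)
  ultimately obtain x where x: "\<And>p. p \<in> I \<Longrightarrow> \<bar>x p\<bar> \<le> b p"
    "\<And>p. p \<in> I \<Longrightarrow> \<bar>x p\<bar> < b p \<Longrightarrow> F p x = 0" "\<And>p. p \<in> I \<Longrightarrow> F p x * x p = - \<bar>F p x\<bar> * b p"
    by (rule box_variational[where F=F and b=b and I=I]) (use contF in auto)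
  define \<mu> where "\<mu> = mu x"
  define \<phi> where "\<phi> = ph x"
  define u where "u = softmax n \<mu>"

  \<comment> \<open>Complementarity makes each product of deviation and Poisson residual
    nonpositive, as \<open>poisson_bound\<close> asks. At Dirichlet vertices the deviation is
    0.\<close>
  have w_le: "\<bar>w x K\<bar> \<le> P0" if K: "K \<in> M" for K
  proof (rule P0(2)[OF _ _ _ K])
    show "\<forall>L\<in>MD. w x L = 0" by (simp add: w_def)
    show "\<forall>L\<in>M. \<bar>rhs \<mu> L\<bar> \<le> g\<^sub>0" using rhs_le by blast
    have "w x K * Fp x K \<le> 0" if "K \<in> M" for K
    proof (cases "K \<in> MD")
      case False
      then have "(0, K) \<in> I" using that by (simp add: I_def)
      from x(3)[OF this] show ?thesis
        using that False P0 by (simp add: F_def b_def w_def mult.commute[of "x _"])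
    qed (simp add: w_def)
    then show "(\<Sum>K\<in>M. w x K * (lam * (\<Sum>S\<in>star K. \<Sum>L\<in>V S. stiff S K L * ((h K + w x K) - (h L + w x L))) - rhs \<mu> K)) \<le> 0"
      unfolding Fp_def ph_def \<mu>_def by (intro sum_nonpos)
  qed
  have Fp0: "Fp x K = 0" if "K \<in> M - MD" for K
  proof -
    have "(0, K) \<in> I" using that by (simp add: I_def)
    from x(2)[OF this] show ?thesis
      using w_le[of K] that by (auto simp: F_def b_def w_def)
  qed
  have \<phi>_le: "\<bar>\<phi> K\<bar> \<le> P" if "K \<in> M" for K
    using w_le[OF that] h_le[OF that] abs_triangle_ineq[of "h K" "w x K"]
    by (simp add: \<phi>_def ph_def P_def)

  define \<rho> where "\<rho> i K = \<bar>Fs x i K\<bar>" for i K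
  define R where "R = (\<Sum>i=1..n. \<Sum>K\<in>M. \<rho> i K)"
  define \<xi> where "\<xi> i = (\<lambda>K. \<mu> i K + \<beta> * z i * \<phi> K)" for i
  define \<delta> where "\<delta> i S = mbl (u 0) S * mbl (u i) S * (D i * (vol S * (norm (dgrad S (\<xi> i)))\<^sup>2))" for i S
  have \<delta>0: "\<delta> i S \<ge> 0" if "i \<in> {1..n}" "S \<in> \<T>" for i S
  proof (cases "V S = {}")
    case True
    then show ?thesis by (simp add: \<delta>_def dgrad_def)
  next
    case False
    then show ?thesis using D[OF that(1)] vol_pos[OF that(2)] mbl_softmax_nonneg[OF that(2) False]
      by (simp add: \<delta>_def u_def)
  qed
  have \<beta>z: "\<bar>\<beta> * z i * \<phi> K\<bar> \<le> \<bar>\<beta>\<bar> * \<bar>z i\<bar> * P" if "K \<in> M" for i K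
    unfolding abs_mult using \<phi>_le[OF that] by (intro mult_left_mono) auto
  have zZ: "\<bar>z i\<bar> \<le> Z" if "i \<in> {1..n}" for i
    unfolding Z_def using member_le_sum[OF that, of "\<lambda>i. \<bar>z i\<bar>"] by simp
  have Fs_eq: "Fs x i K = m K * ((u i K - v i K) / \<tau>) + D i * (\<Sum>S\<in>star K. mbl (u 0) S * mbl (u i) S *
      (\<Sum>L\<in>V S. stiff S K L * (\<xi> i K - \<xi> i L)))" for i K
    unfolding Fs_def \<mu>_def[symmetric] \<phi>_def[symmetric] u_def[symmetric] \<xi>_def
    by (simp add: sum_distrib_left algebra_simps)
  \<comment> \<open>Two choices of \<open>y\<close> matter: \<open>\<xi> i\<close> produces the
    dissipation, the constant 1 the mass balance.\<close>
  have test: "(\<Sum>K\<in>M. y K * Fs x i K) = (\<Sum>K\<in>M. m K / \<tau> * ((u i K - v i K) * y K)) +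
      (\<Sum>S\<in>\<T>. mbl (u 0) S * mbl (u i) S * (D i * (vol S * (dgrad S y \<bullet> dgrad S (\<xi> i)))))" for y i
  proof -
    have "(\<Sum>K\<in>M. y K * Fs x i K) = (\<Sum>K\<in>M. m K / \<tau> * ((u i K - v i K) * y K)) +
      D i * (\<Sum>K\<in>M. y K * (\<Sum>S\<in>star K. (mbl (u 0) S * mbl (u i) S) * (\<Sum>L\<in>V S. stiff S K L * (\<xi> i K - \<xi> i L))))"
    proof -
      have "a * (b * (c / \<tau>) + d * W) = b / \<tau> * (c * a) + d * (a * W)" for a b c d W :: real
        by (simp add: distrib_left)
      then show ?thesis
        unfolding Fs_eq sum_distrib_left[of "D i" _ M] sum.distrib[symmetric]
        by (intro sum.cong refl)
    qed
    then show ?thesis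
      unfolding summation_by_parts by (simp add: sum_distrib_left algebra_simps)
  qed
  \<comment> \<open>The part \<open>\<mu> i\<close> of the test function contributes exactly
    \<open>- B * \<rho> i K\<close> at \<open>K\<close>; the electric part gives back at most
    \<open>|\<beta>| * Z * P * \<rho> i K\<close>.\<close>
  have upper: "(\<Sum>K\<in>M. \<xi> i K * Fs x i K) \<le> - (B - \<bar>\<beta>\<bar> * Z * P) * (\<Sum>K\<in>M. \<rho> i K)"
    if i: "i \<in> {1..n}" for i
    unfolding sum_distrib_left
  proof (intro sum_mono)
    fix K assume K: "K \<in> M"
    have "(i, K) \<in> I" "i \<noteq> 0" using i K by (auto simp: I_def)
    from x(3)[OF this(1)] this(2) have "\<mu> i K * Fs x i K = - B * \<rho> i K"
      by (simp add: F_def b_def \<mu>_def mu_def \<rho>_def mult.commute)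
    moreover have "\<beta> * z i * \<phi> K * Fs x i K \<le> \<bar>\<beta>\<bar> * Z * P * \<rho> i K"
    proof -
      have "\<beta> * z i * \<phi> K * Fs x i K \<le> \<bar>\<beta> * z i * \<phi> K\<bar> * \<bar>Fs x i K\<bar>"
        unfolding abs_mult[symmetric] by (rule abs_ge_self)
      also have "\<dots> \<le> (\<bar>\<beta>\<bar> * \<bar>z i\<bar> * P) * \<bar>Fs x i K\<bar>"
        using \<beta>z[OF K] by (intro mult_right_mono) auto
      also have "\<dots> \<le> (\<bar>\<beta>\<bar> * Z * P) * \<bar>Fs x i K\<bar>"
        using zZ[OF i] P by (intro mult_right_mono mult_left_mono) auto
      finally show ?thesis by (simp add: \<rho>_def)
    qed
    ultimately show "\<xi> i K * Fs x i K \<le> - (B - \<bar>\<beta>\<bar> * Z * P) * \<rho> i K"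
      by (simp add: \<xi>_def algebra_simps)
  qed
  have lower: "(\<Sum>i=1..n. (u i K - v i K) * \<xi> i K) \<ge> - ((real n + 1) + \<bar>\<beta>\<bar> * Z * P)"
    if K: "K \<in> M" for K
  proof -
    have "(\<Sum>i=1..n. (u i K - v i K) * \<mu> i K) \<ge> - (real n + 1)"
      unfolding u_def using v_nonneg v_sum K by (intro softmax_diff_inner_ge) auto
    moreover have "(\<Sum>i=1..n. (u i K - v i K) * (\<beta> * z i * \<phi> K)) \<ge> (\<Sum>i=1..n. - (\<bar>\<beta>\<bar> * \<bar>z i\<bar> * P))"
    proof (intro sum_mono)
      fix i assume i: "i \<in> {1..n}"
      have "v i K \<le> (\<Sum>i=1..n. v i K)" using v_nonneg K by (intro member_le_sum[OF i]) auto
      then have "v i K \<le> 1" using v_sum[OF K] by linarith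
      moreover have "u i K \<le> 1" "u i K \<ge> 0"
        using i softmax_le_1[of i n \<mu> K] softmax_pos[of n \<mu> i K] by (auto simp: u_def)
      ultimately have "\<bar>u i K - v i K\<bar> \<le> 1" using v_nonneg[OF i K] by linarith
      then have "\<bar>(u i K - v i K) * (\<beta> * z i * \<phi> K)\<bar> \<le> 1 * (\<bar>\<beta>\<bar> * \<bar>z i\<bar> * P)"
        unfolding abs_mult[of "u i K - v i K"] using \<beta>z[OF K] by (intro mult_mono) auto
      then show "- (\<bar>\<beta>\<bar> * \<bar>z i\<bar> * P) \<le> (u i K - v i K) * (\<beta> * z i * \<phi> K)" by linarith
    qed
    moreover have "(\<Sum>i=1..n. - (\<bar>\<beta>\<bar> * \<bar>z i\<bar> * P)) = - (\<bar>\<beta>\<bar> * Z * P)"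
      by (simp add: Z_def sum_negf sum_distrib_left sum_distrib_right)
    ultimately show ?thesis by (simp add: \<xi>_def distrib_left sum.distrib)
  qed
  have ener: "R * (B - \<bar>\<beta>\<bar> * Z * P) + (\<Sum>i=1..n. \<Sum>S\<in>\<T>. \<delta> i S) \<le> E"
  proof -
    have "(\<Sum>i=1..n. \<Sum>K\<in>M. \<xi> i K * Fs x i K) \<le> (\<Sum>i=1..n. - (B - \<bar>\<beta>\<bar> * Z * P) * (\<Sum>K\<in>M. \<rho> i K))"
      by (intro sum_mono upper)
    also have "\<dots> = - (R * (B - \<bar>\<beta>\<bar> * Z * P))" unfolding R_def sum_distrib_left[symmetric] by (simp only: minus_mult_left mult.commute)
    finally have 1: "(\<Sum>i=1..n. \<Sum>K\<in>M. \<xi> i K * Fs x i K) \<le> - (R * (B - \<bar>\<beta>\<bar> * Z * P))" .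
    have "(\<Sum>i=1..n. \<Sum>K\<in>M. m K / \<tau> * ((u i K - v i K) * \<xi> i K)) =
        (\<Sum>K\<in>M. m K / \<tau> * (\<Sum>i=1..n. (u i K - v i K) * \<xi> i K))"
      unfolding sum_distrib_left by (rule sum.swap)
    also have "\<dots> \<ge> (\<Sum>K\<in>M. m K / \<tau> * (- ((real n + 1) + \<bar>\<beta>\<bar> * Z * P)))"
      using m \<tau> by (intro sum_mono mult_left_mono lower) (auto intro: less_imp_le)
    also have "(\<Sum>K\<in>M. m K / \<tau> * (- ((real n + 1) + \<bar>\<beta>\<bar> * Z * P))) = - E"
      unfolding E_def m\<^sub>1_def sum_distrib_right[symmetric] sum_divide_distrib[symmetric]
      by (rule mult_minus_right)
    finally have 2: "- E \<le> (\<Sum>i=1..n. \<Sum>K\<in>M. m K / \<tau> * ((u i K - v i K) * \<xi> i K))" .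
    show ?thesis using 1 2
      unfolding test \<delta>_def sum.distrib power2_norm_eq_inner by linarith
  qed
  have R0: "R \<ge> 0" by (auto simp: R_def \<rho>_def intro!: sum_nonneg)
  have diss0: "(\<Sum>i=1..n. \<Sum>S\<in>\<T>. \<delta> i S) \<ge> 0" by (intro sum_nonneg \<delta>0)
  have \<delta>E: "\<delta> i S \<le> E" if "i \<in> {1..n}" "S \<in> \<T>" for i S
  proof -
    have "\<delta> i S \<le> (\<Sum>S\<in>\<T>. \<delta> i S)"
      using finite_cells by (intro member_le_sum[OF that(2)]) (auto intro: \<delta>0[OF that(1)])
    also have "\<dots> \<le> (\<Sum>i=1..n. \<Sum>S\<in>\<T>. \<delta> i S)"
      by (intro member_le_sum[OF that(1)]) (auto intro!: sum_nonneg \<delta>0)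
    also have "\<dots> \<le> E" using ener mult_nonneg_nonneg[OF R0, of "B - \<bar>\<beta>\<bar> * Z * P"] B(2) by linarith
    finally show ?thesis .
  qed
  have bs: "bounded_state n D z \<beta> P E \<mu> \<phi>"
    using \<phi>_le \<delta>E by (simp add: bounded_state_def \<delta>_def \<xi>_def u_def)
  \<comment> \<open>The multipliers \<open>\<rho>\<close> are the defects in the mass balance of each species.\<close>
  have R_small: "\<tau> * R \<le> c / 2"
  proof -
    have "R * (2 * \<tau> * E / c + 1) \<le> E + R"
    proof -
      have "R * (2 * \<tau> * E / c) \<le> R * (B - \<bar>\<beta>\<bar> * Z * P)"
        using B(3) R0 by (rule mult_left_mono)
      then show ?thesis using ener diss0 by (simp add: distrib_left)
    qed
    then have "R * (2 * \<tau> * E / c) \<le> E" by (simp add: distrib_left)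
    then have *: "E * (2 * \<tau> * R) \<le> E * c" using c by (simp add: field_simps)
    have "E > 0" using m1 \<tau> Z0 P by (simp add: E_def add_pos_nonneg)
    then show ?thesis using * by simp
  qed
  have dg1: "dgrad S (\<lambda>_. 1) = 0" if "S \<in> \<T>" for S using sum_G[OF that] by (simp add: dgrad_def)
  \<comment> \<open>A constant has zero gradient, so the fluxes cancel and only the residuals change
    the mass.\<close>
  have massF: "(\<Sum>K\<in>M. m K * u i K) = (\<Sum>K\<in>M. m K * v i K) + \<tau> * (\<Sum>K\<in>M. Fs x i K)" for i
    using test[of "\<lambda>_. 1" i] \<tau> dg1
    by (simp add: sum_divide_distrib[symmetric] right_diff_distrib sum_subtractf)
  have sumF: "\<bar>\<Sum>K\<in>M. Fs x i K\<bar> \<le> (\<Sum>K\<in>M. \<rho> i K)" for i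
    unfolding \<rho>_def by (rule sum_abs)
  have u_mass: "(\<Sum>K\<in>M. m K * u j K) \<ge> \<eta> * (\<Sum>K\<in>M. m K)" if j: "j \<in> {0..n}" for j
  proof -
    have "\<eta> * (\<Sum>K\<in>M. m K) = c / 2" using m1 by (simp add: \<eta>_def m\<^sub>1_def)
    moreover have "mass_of j - \<tau> * R \<le> (\<Sum>K\<in>M. m K * u j K)"
    proof (cases "j = 0")
      case False
      have "(\<Sum>K\<in>M. \<rho> j K) \<le> R"
        unfolding R_def using j False by (intro member_le_sum) (auto simp: \<rho>_def intro!: sum_nonneg)
      then have "- R \<le> (\<Sum>K\<in>M. Fs x j K)" using sumF[of j] by linarith
      then have "\<tau> * (- R) \<le> \<tau> * (\<Sum>K\<in>M. Fs x j K)" using \<tau> by (intro mult_left_mono) auto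
      then show ?thesis using massF[of j] False by (simp add: mass_of_def)
    next
      case True
      \<comment> \<open>The solvent has no equation of its own: its mass is the complement of the
        others, so its defect is the sum of theirs and again at most \<open>R\<close>.\<close>
      have swap: "(\<Sum>K\<in>M. m K * (1 - (\<Sum>i=1..n. w i K))) =
          (\<Sum>K\<in>M. m K) - (\<Sum>i=1..n. \<Sum>K\<in>M. m K * w i K)" for w :: "nat \<Rightarrow> 'v \<Rightarrow> real"
        unfolding sum.swap[of _ M] by (simp add: right_diff_distrib sum_subtractf sum_distrib_left)
      have "u 0 K = 1 - (\<Sum>i=1..n. u i K)" for K
        using softmax_sum[of n \<mu> K] unfolding u_def by linarith
      then have "(\<Sum>K\<in>M. m K * u 0 K) = (\<Sum>K\<in>M. m K * (1 - (\<Sum>i=1..n. u i K)))"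
        by (simp only:)
      also have "\<dots> = (\<Sum>K\<in>M. m K) - (\<Sum>i=1..n. \<Sum>K\<in>M. m K * u i K)"
        by (rule swap)
      also have "\<dots> = (\<Sum>K\<in>M. m K) - (\<Sum>i=1..n. \<Sum>K\<in>M. m K * v i K) - \<tau> * (\<Sum>i=1..n. \<Sum>K\<in>M. Fs x i K)"
        by (simp only: massF sum.distrib sum_distrib_left[symmetric] diff_diff_eq)
      also have "\<dots> = mass_of 0 - \<tau> * (\<Sum>i=1..n. \<Sum>K\<in>M. Fs x i K)"
        unfolding mass_of_def using swap[of v] by simp
      finally have "(\<Sum>K\<in>M. m K * u 0 K) = mass_of 0 - \<tau> * (\<Sum>i=1..n. \<Sum>K\<in>M. Fs x i K)" .
      moreover have "(\<Sum>i=1..n. \<Sum>K\<in>M. Fs x i K) \<le> R"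
        unfolding R_def \<rho>_def by (intro sum_mono) auto
      ultimately show ?thesis using True \<tau> by (simp add: mult_left_mono)
    qed
    ultimately show ?thesis using c_le[OF j] R_small by linarith
  qed
  have "\<forall>j\<in>{0..n}. \<exists>K\<in>M. softmax n \<mu> j K \<ge> \<eta>"
    using exists_ge_average[OF M_ne m u_mass] by (simp add: u_def)
  from B0(2)[OF bs this] have \<mu>_le: "\<bar>\<mu> i K\<bar> < B" if "i \<in> {1..n}" "K \<in> M" for i K
    using that B(1) by fastforce
  have Fs0: "Fs x i K = 0" if "i \<in> {1..n}" "K \<in> M" for i K
  proof -
    have "(i, K) \<in> I" "i \<noteq> 0" using that by (auto simp: I_def)
    then show ?thesis using x(2)[of "(i, K)"] \<mu>_le[OF that]
      by (simp add: F_def b_def \<mu>_def mu_def)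
  qed
  show ?thesis
  proof (rule that[of \<mu> \<phi>])
    fix i K assume "i \<in> {1..n}" "K \<in> M"
    from Fs0[OF this] show "m K * ((softmax n \<mu> i K - v i K) / \<tau>) +
       (\<Sum>S\<in>star K. \<Sum>L\<in>V S. mbl (softmax n \<mu> 0) S * mbl (softmax n \<mu> i) S *
          (D i * stiff S K L * ((\<mu> i K - \<mu> i L) + \<beta> * z i * (\<phi> K - \<phi> L)))) = 0"
      by (simp add: Fs_def \<mu>_def \<phi>_def)
  next
    fix K assume "K \<in> MD"
    then show "\<phi> K = h K" by (simp add: \<phi>_def ph_def w_def)
  next
    fix K assume "K \<in> M - MD"
    from Fp0[OF this] show "lam * (\<Sum>S\<in>star K. \<Sum>L\<in>V S. stiff S K L * (\<phi> K - \<phi> L)) =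
       m K * (\<Sum>i=1..n. z i * softmax n \<mu> i K) + g K"
      by (simp add: Fp_def \<phi>_def \<mu>_def rhs_def)
  qed
qed

end

section \<open>Geometry of simplicial meshes\<close>

lemma affine_functions_agree_convex_hull:
  fixes a a' :: "'a::euclidean_space"
  assumes "\<And>x. x \<in> X \<Longrightarrow> a \<bullet> x + b = a' \<bullet> x + b'" and "x \<in> convex hull X"
  shows "a \<bullet> x + b = a' \<bullet> x + b'"
proof -
  have "convex hull X \<subseteq> {x. (a - a') \<bullet> x = b' - b}"
    using assms(1) by (intro hull_minimal convex_hyperplane) (auto simp: inner_diff_left algebra_simps)
  then show ?thesis using assms(2) by (auto simp: inner_diff_left algebra_simps)
qed

lemma affine_functions_agree_UNIV:
  fixes a a' :: "'a::euclidean_space"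
  assumes "\<And>x. x \<in> X \<Longrightarrow> a \<bullet> x + b = a' \<bullet> x + b'" and "affine hull X = UNIV"
  shows "a = a' \<and> b = b'"
proof -
  have "affine hull X \<subseteq> {x. (a - a') \<bullet> x = b' - b}"
    using assms(1) by (intro hull_minimal affine_hyperplane) (auto simp: inner_diff_left algebra_simps)
  then have *: "(a - a') \<bullet> x = b' - b" for x using assms(2) by auto
  from *[of 0] have "b = b'" by simp
  with *[of "a - a'"] show ?thesis by simp
qed

text \<open>Differences from a base point \<open>x0\<close> are linearly independent, so the values
  extend linearly; the adjoint turns the functional into an inner product.\<close>

lemma affine_interpolation:
  fixes C :: "'a::euclidean_space set" and f :: "'a \<Rightarrow> real"
  assumes "\<not> affine_dependent C"
  obtains a b where "\<And>x. x \<in> C \<Longrightarrow> a \<bullet> x + b = f x"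
proof (cases "C = {}")
  case True
  then show ?thesis using that by auto
next
  case False
  then obtain x0 where x0: "x0 \<in> C" by auto
  then have "independent ((\<lambda>x. - x0 + x) ` (C - {x0}))"
    using assms affine_dependent_iff_dependent2 by blast
  then obtain g where g: "linear g"
    "\<forall>y\<in>(\<lambda>x. - x0 + x) ` (C - {x0}). g y = f (y + x0) - f x0"
    using linear_independent_extend[of "(\<lambda>x. - x0 + x) ` (C - {x0})" "\<lambda>y. f (y + x0) - f x0"] by blast
  have inner: "adjoint g 1 \<bullet> x = g x" for x
    using adjoint_works[OF g(1), of x 1] by (simp add: inner_commute)
  have "g (x - x0) = f x - f x0" if "x \<in> C" for x
  proof (cases "x = x0")
    case True
    then show ?thesis using linear_0[OF g(1)] by simp
  next
    case False
    then have "- x0 + x \<in> (\<lambda>x. - x0 + x) ` (C - {x0})" using that by blast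
    then show ?thesis using g(2) by (fastforce simp: add.commute)
  qed
  then have "adjoint g 1 \<bullet> x + (f x0 - g x0) = f x" if "x \<in> C" for x
    using that inner linear_diff[OF g(1), of x x0] by fastforce
  then show ?thesis by (rule that)
qed

text \<open>The generating points affinely span the space, so the interior of their convex hull is
  nonempty and its closure is the hull again, whose extreme points are exactly these points.\<close>

lemma open_simplexD:
  fixes S :: "(real^'d) set"
  assumes "open_simplex S"
  shows "\<not> affine_dependent (vertices S)" "finite (vertices S)" "card (vertices S) = CARD('d) + 1"
    "closure S = convex hull (vertices S)" "affine hull (vertices S) = UNIV"
    "open S" "S \<noteq> {}" "convex S" "S = interior (closure S)"
proof -
  obtain C where C: "finite C" "\<not> affine_dependent C" "card C = CARD('d) + 1"
    "S = interior (convex hull C)"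
    using assms unfolding open_simplex_def simplex by auto
  have hull: "affine hull C = UNIV"
    using C by (intro affine_independent_span_eq) auto
  have "C \<noteq> {}" using C by auto
  then have ne: "interior (convex hull C) \<noteq> {}"
    using rel_interior_eq_empty[OF convex_convex_hull, of C] rel_interior_interior[of "convex hull C"] hull
    by (simp add: affine_hull_convex_hull)
  have cl: "closure S = convex hull C"
    using convex_closure_interior[OF convex_convex_hull ne] C(1,4)
    by (simp add: finite_imp_compact_convex_hull compact_imp_closed)
  then have V: "vertices S = C"
    by (auto simp: vertices_def extreme_point_of_convex_hull_affine_independent[OF C(2)])
  show "\<not> affine_dependent (vertices S)" "finite (vertices S)" "card (vertices S) = CARD('d) + 1"
    "closure S = convex hull (vertices S)" "affine hull (vertices S) = UNIV"
    "open S" "S \<noteq> {}" "convex S" "S = interior (closure S)"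
    using V C hull cl ne by (auto intro: convex_interior)
qed

lemma vertices_subset_closure: "vertices S \<subseteq> closure S"
  by (auto simp: vertices_def extreme_point_of_def)

lemma grad_affine:
  fixes S :: "(real^'d) set"
  assumes "open S" "x \<in> S" "\<And>x. x \<in> S \<Longrightarrow> v x = a \<bullet> x + b"
  shows "grad v x = a"
proof -
  have "((\<lambda>x. a \<bullet> x + b) has_derivative (\<lambda>h. a \<bullet> h)) (at x)"
    by (auto intro!: derivative_eq_intros)
  then have "(v has_derivative (\<lambda>h. a \<bullet> h)) (at x)"
    by (rule has_derivative_transform_within_open[OF _ assms(1,2)]) (simp add: assms(3))
  then have "frechet_derivative v (at x) = (\<lambda>h. a \<bullet> h)"
    by (rule frechet_derivative_at[symmetric])
  then show ?thesis by (simp add: grad_def vec_eq_iff inner_axis)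
qed

lemma cell_grad_affine:
  fixes S :: "(real^'d) set"
  assumes "open S" "S \<noteq> {}" "\<And>x. x \<in> S \<Longrightarrow> v x = a \<bullet> x + b"
  shows "cell_grad v S = a"
  unfolding cell_grad_def using grad_affine[OF assms(1) _ assms(3)] assms(2)
  by (intro the_equality) fastforce+

locale mesh =
  fixes \<Omega> :: "(real^'d) set" and \<T> :: "(real^'d) set set"
  assumes open_domain: "open \<Omega>" and bounded_domain: "bounded \<Omega>"
    and mesh: "simplicial_mesh \<Omega> \<T>"
begin

abbreviation "M \<equiv> mesh_vertices \<T>"

lemma finite_cells: "finite \<T>"
  and cell: "S \<in> \<T> \<Longrightarrow> open_simplex S"
  and closure_domain: "closure \<Omega> = (\<Union>S\<in>\<T>. closure S)"
  and conforming: "S \<in> \<T> \<Longrightarrow> S' \<in> \<T> \<Longrightarrow> closure S \<inter> closure S' face_of closure S"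
  using mesh by (auto simp: simplicial_mesh_def)

lemmas simplexD = open_simplexD[OF cell]

lemma finite_mesh_vertices: "finite M"
  unfolding mesh_vertices_def using finite_cells simplexD(2) by blast

lemma mesh_vertex_closure: "K \<in> M \<Longrightarrow> K \<in> closure \<Omega>"
  unfolding mesh_vertices_def closure_domain using vertices_subset_closure by blast

lemma P1_affine:
  assumes w: "w \<in> P1_space \<Omega> \<T>" and S: "S \<in> \<T>"
  obtains b where "\<And>x. x \<in> closure S \<Longrightarrow> w x = cell_grad w S \<bullet> x + b"
proof -
  obtain a b where ab: "\<forall>x\<in>S. w x = a \<bullet> x + b" using w S unfolding P1_space_def by blast
  have "continuous_on (closure S) w"
    using w S closure_domain by (auto simp: P1_space_def intro: continuous_on_subset)
  then have cont: "continuous_on (closure S) (\<lambda>x. w x - (a \<bullet> x + b))"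
    by (intro continuous_intros)
  have "w x - (a \<bullet> x + b) = 0" if "x \<in> closure S" for x
    by (rule continuous_constant_on_closure[OF cont _ that]) (use ab in auto)
  moreover have "cell_grad w S = a"
    using ab simplexD(6,7)[OF S] by (intro cell_grad_affine) auto
  ultimately show ?thesis using that[of b] by simp
qed

lemma P1_eq_on_cell:
  assumes w: "w \<in> P1_space \<Omega> \<T>" and S: "S \<in> \<T>"
    and ab: "\<And>x. x \<in> vertices S \<Longrightarrow> w x = a \<bullet> x + b" and x: "x \<in> closure S"
  shows "w x = a \<bullet> x + b"
proof -
  obtain c where c: "\<And>x. x \<in> closure S \<Longrightarrow> w x = cell_grad w S \<bullet> x + c"
    using P1_affine[OF w S] by blast
  have "cell_grad w S \<bullet> x + c = a \<bullet> x + b"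
    by (rule affine_functions_agree_convex_hull[of "vertices S"])
      (use c ab x simplexD(4)[OF S] vertices_subset_closure in force)+
  then show ?thesis using c[OF x] by simp
qed

text \<open>Gluing the affine pieces rests on conformity: two closed cells meet in a face of both,
  the convex hull of extreme points that are vertices of both, where the pieces share the prescribed
  values. Uniqueness justifies the definite description in \<open>nodal_basis\<close>.\<close>

lemma interpolant: "\<exists>!w. w \<in> P1_space \<Omega> \<T> \<and> (\<forall>L\<in>M. w L = f L)"
proof -
  have "\<exists>a b. \<forall>x\<in>vertices S. a \<bullet> x + b = f x" if "S \<in> \<T>" for S
    using affine_interpolation[OF simplexD(1)[OF that], of f] by metis
  then obtain a b where ab: "\<And>S x. S \<in> \<T> \<Longrightarrow> x \<in> vertices S \<Longrightarrow> a S \<bullet> x + b S = f x" by metis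
  have agree: "a S \<bullet> x + b S = a S' \<bullet> x + b S'"
    if "S \<in> \<T>" "S' \<in> \<T>" "x \<in> closure S" "x \<in> closure S'" for S S' x
  proof -
    define F where "F = closure S \<inter> closure S'"
    have F: "F face_of closure S" "F face_of closure S'"
      using conforming[OF that(1,2)] conforming[OF that(2,1)] by (auto simp: F_def Int_commute)
    have "compact (closure S)" "convex (closure S)" "compact (closure S')" "convex (closure S')"
      using simplexD(2,4)[OF that(1)] simplexD(2,4)[OF that(2)]
      by (simp_all add: finite_imp_compact_convex_hull)
    then have "F = convex hull {e. e extreme_point_of F}"
      unfolding F_def by (intro Krein_Milman_Minkowski compact_Int convex_Int)
    then have x: "x \<in> convex hull {e. e extreme_point_of F}" using that by (auto simp: F_def)
    show ?thesis
    proof (rule affine_functions_agree_convex_hull[OF _ x])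
      fix e assume "e \<in> {e. e extreme_point_of F}"
      then have "e \<in> vertices S" "e \<in> vertices S'"
        using extreme_point_of_face[OF F(1)] extreme_point_of_face[OF F(2)] by (auto simp: vertices_def)
      then show "a S \<bullet> e + b S = a S' \<bullet> e + b S'" using ab that by simp
    qed
  qed
  define w where "w x = (if x \<in> closure \<Omega> then
      let S = SOME S. S \<in> \<T> \<and> x \<in> closure S in a S \<bullet> x + b S else 0)" for x
  have w: "w x = a S \<bullet> x + b S" if "S \<in> \<T>" "x \<in> closure S" for S x
  proof -
    let ?S = "SOME S. S \<in> \<T> \<and> x \<in> closure S"
    have S: "?S \<in> \<T> \<and> x \<in> closure ?S" by (rule someI[of _ S]) (use that in simp)
    have "x \<in> closure \<Omega>" using that closure_domain by blast
    then have "w x = a ?S \<bullet> x + b ?S" by (simp add: w_def Let_def)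
    also have "\<dots> = a S \<bullet> x + b S" using S that by (intro agree) auto
    finally show ?thesis .
  qed
  have "continuous_on (\<Union>S\<in>\<T>. closure S) w"
  proof (rule continuous_on_closed_Union)
    fix S assume S: "S \<in> \<T>"
    have "continuous_on (closure S) (\<lambda>x. a S \<bullet> x + b S)" by (intro continuous_intros)
    then show "continuous_on (closure S) w"
      by (rule continuous_on_eq) (simp add: w[OF S])
  qed (auto simp: finite_cells)
  then have "continuous_on (closure \<Omega>) w" by (simp only: closure_domain)
  moreover have "\<forall>x\<in>S. w x = a S \<bullet> x + b S" if "S \<in> \<T>" for S
    using w[OF that] closure_subset[of S] by blast
  moreover have "w x = 0" if "x \<notin> closure \<Omega>" for x using that by (simp add: w_def)
  ultimately have w1: "w \<in> P1_space \<Omega> \<T>" unfolding P1_space_def by blast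
  have w2: "w L = f L" if L: "L \<in> M" for L
  proof -
    obtain S where S: "S \<in> \<T>" "L \<in> vertices S" using L unfolding mesh_vertices_def by blast
    then show ?thesis using w[OF S(1), of L] ab[OF S] vertices_subset_closure by auto
  qed
  show ?thesis
  proof (rule ex1I[of _ w])
    show "w \<in> P1_space \<Omega> \<T> \<and> (\<forall>L\<in>M. w L = f L)" using w1 w2 by blast
    fix v assume v: "v \<in> P1_space \<Omega> \<T> \<and> (\<forall>L\<in>M. v L = f L)"
    show "v = w"
    proof
      fix x
      show "v x = w x"
      proof (cases "x \<in> closure \<Omega>")
        case True
        then obtain S where S: "S \<in> \<T>" "x \<in> closure S" using closure_domain by auto
        have "v x = a S \<bullet> x + b S"
          by (rule P1_eq_on_cell[OF _ S(1) _ S(2)]) (use v ab S in \<open>auto simp: mesh_vertices_def\<close>)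
        then show ?thesis using w S by simp
      qed (use v in \<open>auto simp: w_def P1_space_def\<close>)
    qed
  qed
qed

abbreviation "hat \<equiv> nodal_basis \<Omega> \<T>"

lemma nodal_basis: "hat K \<in> P1_space \<Omega> \<T> \<and> (\<forall>L\<in>M. hat K L = (if L = K then 1 else 0))"
  unfolding nodal_basis_def by (rule theI'[OF interpolant])

lemma nodal_basis_P1: "hat K \<in> P1_space \<Omega> \<T>"
  and nodal_basis_vertex: "L \<in> M \<Longrightarrow> hat K L = (if L = K then 1 else 0)"
  using nodal_basis[of K] by blast+

lemma nodal_grad_diff:
  assumes "S \<in> \<T>" "x \<in> vertices S" "y \<in> vertices S"
  shows "cell_grad (hat K) S \<bullet> (x - y) = (if x = K then 1 else 0) - (if y = K then 1 else 0)"
proof -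
  obtain b where b: "\<And>x. x \<in> closure S \<Longrightarrow> hat K x = cell_grad (hat K) S \<bullet> x + b"
    using P1_affine[OF nodal_basis_P1 assms(1)] by blast
  have "x \<in> M" "y \<in> M" using assms by (auto simp: mesh_vertices_def)
  moreover have "x \<in> closure S" "y \<in> closure S" using assms vertices_subset_closure by blast+
  ultimately show ?thesis
    using b[of x] b[of y] nodal_basis_vertex[of x K] nodal_basis_vertex[of y K]
    by (simp add: inner_diff_right split: if_splits)
qed

text \<open>The vertices of a cell affinely span the space, so comparing the sum of the hats with 1
  there determines value and gradient together.\<close>

lemma nodal_basis_partition_of_unity:
  assumes S: "S \<in> \<T>" and x: "x \<in> closure S"
  shows "(\<Sum>L\<in>vertices S. hat L x) = 1" and "K \<notin> vertices S \<Longrightarrow> hat K x = 0"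
    and "(\<Sum>L\<in>vertices S. cell_grad (hat L) S) = 0"
proof -
  have "\<exists>b. \<forall>x\<in>closure S. hat K x = cell_grad (hat K) S \<bullet> x + b" for K
    using P1_affine[OF nodal_basis_P1 S, of K] by metis
  then obtain b where b: "\<And>K x. x \<in> closure S \<Longrightarrow> hat K x = cell_grad (hat K) S \<bullet> x + b K" by metis
  have sum: "(\<Sum>L\<in>vertices S. hat L x) = (\<Sum>L\<in>vertices S. cell_grad (hat L) S) \<bullet> x + (\<Sum>L\<in>vertices S. b L)"
    if "x \<in> closure S" for x
    by (simp add: inner_sum_left sum.distrib b[OF that])
  have "(\<Sum>L\<in>vertices S. cell_grad (hat L) S) = 0 \<and> (\<Sum>L\<in>vertices S. b L) = 1"
  proof (rule affine_functions_agree_UNIV[OF _ simplexD(5)[OF S]])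
    fix x assume x: "x \<in> vertices S"
    then have "x \<in> M" "x \<in> closure S" using S vertices_subset_closure by (auto simp: mesh_vertices_def)
    then have "(\<Sum>L\<in>vertices S. hat L x) = 1"
      using x simplexD(2)[OF S] by (simp add: nodal_basis_vertex)
    then show "(\<Sum>L\<in>vertices S. cell_grad (hat L) S) \<bullet> x + (\<Sum>L\<in>vertices S. b L) = 0 \<bullet> x + 1"
      using sum[OF \<open>x \<in> closure S\<close>] by simp
  qed
  then show "(\<Sum>L\<in>vertices S. hat L x) = 1" "(\<Sum>L\<in>vertices S. cell_grad (hat L) S) = 0"
    using sum[OF x] by auto
  assume K: "K \<notin> vertices S"
  have "hat K x = 0 \<bullet> x + 0"
  proof (rule P1_eq_on_cell[OF nodal_basis_P1 S _ x])
    fix y assume y: "y \<in> vertices S"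
    then have "y \<in> M" using S by (auto simp: mesh_vertices_def)
    then show "hat K y = 0 \<bullet> y + 0" using K y by (auto simp: nodal_basis_vertex)
  qed
  then show "hat K x = 0" by simp
qed

text \<open>The difference is the gradient of the interpolant paired with the edge
  \<open>K - L\<close>. The added 1 provides the strict positivity in \<open>c0_pos\<close>.\<close>

lemma nodal_diff_le:
  assumes S: "S \<in> \<T>" and K: "K \<in> vertices S" and L: "L \<in> vertices S"
  shows "\<bar>v K - v L\<bar> \<le> (diameter (closure \<Omega>) + 1) * norm (\<Sum>J\<in>vertices S. v J *\<^sub>R cell_grad (hat J) S)"
proof -
  let ?g = "\<Sum>J\<in>vertices S. v J *\<^sub>R cell_grad (hat J) S"
  have "?g \<bullet> (K - L) = (\<Sum>J\<in>vertices S. (if K = J then v J else 0) - (if L = J then v J else 0))"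
    unfolding inner_sum_left by (intro sum.cong) (auto simp: nodal_grad_diff[OF S K L])
  also have "\<dots> = v K - v L" using K L simplexD(2)[OF S] by (simp add: sum_subtractf)
  finally have "v K - v L = ?g \<bullet> (K - L)" ..
  then have "\<bar>v K - v L\<bar> \<le> norm ?g * norm (K - L)" using Cauchy_Schwarz_ineq2[of ?g "K - L"] by simp
  also have "norm (K - L) \<le> diameter (closure \<Omega>)"
  proof -
    have "K \<in> M" "L \<in> M" using K L S by (auto simp: mesh_vertices_def)
    then show ?thesis
      using diameter_bounded_bound[of "closure \<Omega>" K L] mesh_vertex_closure bounded_domain
      by (simp add: dist_norm bounded_closure)
  qed
  finally have "\<bar>v K - v L\<bar> \<le> norm ?g * diameter (closure \<Omega>)" by (simp add: mult_left_mono)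
  also have "\<dots> \<le> norm ?g * diameter (closure \<Omega>) + norm ?g" by simp
  also have "\<dots> = (diameter (closure \<Omega>) + 1) * norm ?g" by (simp add: algebra_simps)
  finally show ?thesis .
qed

text \<open>Turns topological connectedness of \<open>\<Omega>\<close> into the combinatorial one of
  the abstract complex: a continuous function with values in \<open>{0, 1}\<close> on the connected
  closure is constant.\<close>

lemma mesh_connected:
  assumes "connected \<Omega>" and R: "R \<subseteq> M" "R \<noteq> {}"
    and closed: "\<And>S. S \<in> \<T> \<Longrightarrow> vertices S \<inter> R \<noteq> {} \<Longrightarrow> vertices S \<subseteq> R"
  shows "R = M"
proof -
  \<comment> \<open>The interpolant of the indicator function of \<open>R\<close> is constant on each cell.\<close>
  obtain w where w: "w \<in> P1_space \<Omega> \<T>" "\<And>L. L \<in> M \<Longrightarrow> w L = (if L \<in> R then 1 else 0)"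
    using interpolant[of "\<lambda>L. if L \<in> R then 1 else 0"] by blast
  have "w x \<in> {0, 1}" if x: "x \<in> closure \<Omega>" for x
  proof -
    obtain S where S: "S \<in> \<T>" "x \<in> closure S" using x closure_domain by auto
    have sub: "vertices S \<subseteq> M" using S by (auto simp: mesh_vertices_def)
    have "w x = 0 \<bullet> x + (if vertices S \<inter> R = {} then 0 else 1)"
    proof (rule P1_eq_on_cell[OF w(1) S(1) _ S(2)])
      fix y assume y: "y \<in> vertices S"
      have "y \<in> R \<longleftrightarrow> vertices S \<inter> R \<noteq> {}" using y closed[OF S(1)] by blast
      moreover have "y \<in> M" using y sub by blast
      ultimately show "w y = 0 \<bullet> y + (if vertices S \<inter> R = {} then 0 else 1)"
        by (simp add: w(2))
    qed
    then show ?thesis by auto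
  qed
  then have "w ` closure \<Omega> \<subseteq> {0, 1}" by blast
  then have "finite (w ` closure \<Omega>)" by (rule finite_subset) simp
  then have "w constant_on closure \<Omega>"
    using w(1) assms(1) by (intro continuous_finite_range_constant connected_imp_connected_closure)
      (auto simp: P1_space_def)
  then obtain c where c: "\<And>L. L \<in> M \<Longrightarrow> w L = c" using mesh_vertex_closure by (auto simp: constant_on_def)
  have "L \<in> R" if "L \<in> M" for L
  proof -
    obtain K where K: "K \<in> R" using R by blast
    then have "w K = 1" "w K = c" using w(2)[of K] c[of K] R by auto
    then show ?thesis using c[OF that] w(2)[OF that] by (simp split: if_splits)
  qed
  then show ?thesis using R by auto
qed

text \<open>\<open>K\<close> may lie on the boundary, outside \<open>\<Omega>\<close>. The strict
  inequalities hold at \<open>K\<close>, hence on a relatively open neighbourhood in the closure,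
  and this neighbourhood meets \<open>\<Omega>\<close>.\<close>

lemma dual_cell_open_nonempty:
  assumes K: "K \<in> M"
  shows "open (dual_cell \<Omega> \<T> K)" "dual_cell \<Omega> \<T> K \<noteq> {}"
proof -
  define U where "U L = closure \<Omega> \<inter> (\<lambda>x. hat K x - hat L x) -` {0<..}" for L
  have "openin (top_of_set (closure \<Omega>)) (U L)" for L
    unfolding U_def using nodal_basis_P1
    by (intro continuous_openin_preimage_gen continuous_intros) (auto simp: P1_space_def)
  then have "openin (top_of_set (closure \<Omega>)) (closure \<Omega> \<inter> (\<Inter>L\<in>M - {K}. U L))"
    using openin_INT[of "M - {K}" "top_of_set (closure \<Omega>)" U] finite_mesh_vertices
    by (simp add: Int_commute)
  then obtain W where W: "open W" "closure \<Omega> \<inter> (\<Inter>L\<in>M - {K}. U L) = closure \<Omega> \<inter> W"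
    unfolding openin_open by blast
  have dual: "dual_cell \<Omega> \<T> K = \<Omega> \<inter> W"
  proof -
    have "dual_cell \<Omega> \<T> K = \<Omega> \<inter> (closure \<Omega> \<inter> (\<Inter>L\<in>M - {K}. U L))"
      using closure_subset[of \<Omega>] by (auto simp: dual_cell_def U_def)
    also have "\<dots> = \<Omega> \<inter> (closure \<Omega> \<inter> W)" by (simp only: W)
    finally show ?thesis using closure_subset[of \<Omega>] by blast
  qed
  have "K \<in> closure \<Omega> \<inter> (\<Inter>L\<in>M - {K}. U L)"
    using mesh_vertex_closure[OF K] K by (auto simp: U_def nodal_basis_vertex)
  then have "K \<in> W \<inter> closure \<Omega>" using W by blast
  then show "dual_cell \<Omega> \<T> K \<noteq> {}"
    using open_Int_closure_eq_empty[OF W(1), of \<Omega>] dual by blast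
  show "open (dual_cell \<Omega> \<T> K)" using dual W open_domain by auto
qed

lemma dual_cell_lmeasurable: "K \<in> M \<Longrightarrow> dual_cell \<Omega> \<T> K \<in> lmeasurable"
  using dual_cell_open_nonempty(1) bounded_domain
  by (intro lmeasurable_open bounded_subset[OF bounded_domain]) (auto simp: dual_cell_def)

lemma dual_cell_measure_pos: "K \<in> M \<Longrightarrow> measure lebesgue (dual_cell \<Omega> \<T> K) > 0"
  using open_not_negligible[OF dual_cell_open_nonempty] negligible_iff_measure0[OF dual_cell_lmeasurable]
  by (simp add: order.strict_iff_order)

text \<open>A point lies in no dual cell only if two hats of its cell tie for the maximum. Such ties
  lie on hyperplanes, since the gradients of the hats of \<open>K\<close> and \<open>L\<close>
  differ in the direction \<open>K - L\<close>.\<close>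

lemma dual_cells_cover: "negligible (\<Omega> - (\<Union>K\<in>M. dual_cell \<Omega> \<T> K))"
proof -
  define g where "g S K = cell_grad (hat K) S" for S K
  have "\<exists>b. \<forall>x\<in>closure S. hat K x = g S K \<bullet> x + b" if "S \<in> \<T>" for S K
    unfolding g_def using P1_affine[OF nodal_basis_P1 that, of K] by metis
  then obtain b where b: "hat K x = g S K \<bullet> x + b S K" if "S \<in> \<T>" "x \<in> closure S" for S K x
    using that[of "\<lambda>S K. SOME b. \<forall>x\<in>closure S. hat K x = g S K \<bullet> x + b"] by (metis (mono_tags, lifting) someI)
  define H where "H S K L = {x. (g S K - g S L) \<bullet> x = b S L - b S K}" for S K L
  let ?N = "(\<Union>S\<in>\<T>. frontier S) \<union> (\<Union>S\<in>\<T>. \<Union>K\<in>vertices S. \<Union>L\<in>vertices S - {K}. H S K L)"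
  have "negligible (H S K L)" if "S \<in> \<T>" "K \<in> vertices S" "L \<in> vertices S - {K}" for S K L
  proof -
    have "g S K \<bullet> (K - L) = 1" "g S L \<bullet> (K - L) = - 1"
      using that by (auto simp: g_def nodal_grad_diff)
    then have "g S K - g S L \<noteq> 0" by auto
    then show ?thesis unfolding H_def by (intro negligible_hyperplane) auto
  qed
  moreover have "negligible (frontier S)" if "S \<in> \<T>" for S
    using simplexD(8)[OF that] by (rule negligible_convex_frontier)
  ultimately have N: "negligible ?N"
    by (intro negligible_Un negligible_Union finite_imageI)
      (auto intro!: negligible_Union finite_imageI finite_cells simplexD(2))
  have "\<Omega> - (\<Union>K\<in>M. dual_cell \<Omega> \<T> K) \<subseteq> ?N"
  proof (intro subsetI, rule ccontr)
    fix x assume x: "x \<in> \<Omega> - (\<Union>K\<in>M. dual_cell \<Omega> \<T> K)" and N: "x \<notin> ?N"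
    then have "x \<in> closure \<Omega>" using closure_subset by blast
    then obtain S where S: "S \<in> \<T>" "x \<in> closure S" using closure_domain by auto
    have ne: "vertices S \<noteq> {}" "finite (vertices S)" using simplexD(2,3)[OF S(1)] by auto
    have "Max ((\<lambda>L. hat L x) ` vertices S) \<in> (\<lambda>L. hat L x) ` vertices S"
      using ne by (intro Max_in) auto
    then obtain K where K: "K \<in> vertices S" "Max ((\<lambda>L. hat L x) ` vertices S) = hat K x" by blast
    have le: "hat L x \<le> hat K x" if "L \<in> vertices S" for L
      using Max_ge[of "(\<lambda>L. hat L x) ` vertices S" "hat L x"] that ne unfolding K(2) by blast
    \<comment> \<open>The hats of a cell sum to 1, so the largest is positive and beats those of all
      other vertices, which vanish on the cell.\<close>
    have pos: "hat K x > 0"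
    proof (rule ccontr)
      assume "\<not> hat K x > 0"
      then have "(\<Sum>L\<in>vertices S. hat L x) \<le> 0" using le by (intro sum_nonpos) force
      then show False using nodal_basis_partition_of_unity(1)[OF S] by simp
    qed
    have "hat L x < hat K x" if "L \<noteq> K" for L
    proof (cases "L \<in> vertices S")
      case True
      then have "x \<notin> H S K L" using N S K that by blast
      then have "hat L x \<noteq> hat K x" by (auto simp: H_def b[OF S] inner_diff_left)
      then show ?thesis using le[OF True] by simp
    next
      case False
      then show ?thesis using nodal_basis_partition_of_unity(2)[OF S False] pos by simp
    qed
    then have "x \<in> dual_cell \<Omega> \<T> K" using x by (auto simp: dual_cell_def)
    moreover have "K \<in> M" using K S by (auto simp: mesh_vertices_def)
    ultimately show False using x by blast
  qed
  then show ?thesis by (rule negligible_subset[OF N])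
qed

lemma disjoint_dual_cells: "K \<in> M \<Longrightarrow> L \<in> M \<Longrightarrow> K \<noteq> L \<Longrightarrow> dual_cell \<Omega> \<T> K \<inter> dual_cell \<Omega> \<T> L = {}"
  by (fastforce simp: dual_cell_def)

end

section \<open>Integration on dual cells\<close>

text \<open>The integration by parts behind the weak gradient 0 of a constant.\<close>

lemma integral_grad_test_function:
  fixes \<Omega> :: "(real^'d) set"
  assumes psi: "test_function \<Omega> \<psi>" and \<Omega>: "open \<Omega>"
  shows "(\<integral>x. grad \<psi> x $ i \<partial>lebesgue_on \<Omega>) = 0"
proof -
  define K where "K = closure {x. \<psi> x \<noteq> 0}"
  have K: "compact K" "K \<subseteq> \<Omega>" using psi by (auto simp: test_function_def K_def)
  define g where "g = (\<lambda>x. grad \<psi> x $ i)"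
  define v :: "real^'d" where "v = axis i 1"
  have "smooth \<psi>" using psi by (simp add: test_function_def)
  then have diff: "\<psi> differentiable at x" and "smooth g" for x
    unfolding g_def by (auto elim: smooth.cases)
  then have diff': "g differentiable at x" for x by (auto elim: smooth.cases)
  have cont_\<psi>: "continuous_on UNIV \<psi>" and cont_g: "continuous_on UNIV g"
    using diff diff' differentiable_imp_continuous_within continuous_at_imp_continuous_on by blast+
  have \<psi>0: "\<psi> x = 0" if "x \<notin> K" for x
    using that closure_subset[of "{x. \<psi> x \<noteq> 0}"] by (auto simp: K_def)
  have g0: "g x = 0" if "x \<notin> K" for x
  proof -
    have "open (- K)" using K(1) by (simp add: compact_imp_closed open_Compl)
    then have "grad \<psi> x = 0"
      by (rule grad_affine[of "- K" x _ 0 0]) (use that \<psi>0 in auto)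
    then show ?thesis by (simp add: g_def)
  qed
  have "bounded (g ` K)"
    using K(1) cont_g by (intro compact_imp_bounded compact_continuous_image) (auto intro: continuous_on_subset)
  then obtain B where B: "B > 0" "\<And>x. x \<in> K \<Longrightarrow> \<bar>g x\<bar> \<le> B"
    unfolding bounded_pos by auto
  have gB: "\<bar>g x\<bar> \<le> B" for x using B g0[of x] by (cases "x \<in> K") auto
  obtain r where r: "\<And>x. x \<in> K \<Longrightarrow> norm x \<le> r"
    using compact_imp_bounded[OF K(1)] unfolding bounded_iff by auto
  have deriv: "((\<lambda>s. \<psi> (x + s *\<^sub>R v)) has_real_derivative g (x + s *\<^sub>R v)) (at s)" for x s
  proof -
    have "(\<psi> has_derivative frechet_derivative \<psi> (at (x + s *\<^sub>R v))) (at (x + s *\<^sub>R v))"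
      using diff frechet_derivative_works by blast
    moreover have "((\<lambda>s. x + s *\<^sub>R v) has_derivative (\<lambda>s. s *\<^sub>R v)) (at s)"
      by (auto intro!: derivative_eq_intros)
    ultimately have "((\<lambda>s. \<psi> (x + s *\<^sub>R v)) has_derivative
        (\<lambda>h. frechet_derivative \<psi> (at (x + s *\<^sub>R v)) (h *\<^sub>R v))) (at s)"
      by (rule has_derivative_compose[rotated])
    moreover have "frechet_derivative \<psi> (at y) (h *\<^sub>R v) = g y * h" for y h
      using linear_cmul[OF linear_frechet_derivative[OF diff], of y h v] by (simp add: g_def grad_def v_def)
    ultimately show ?thesis by (simp add: has_field_derivative_def)
  qed
  \<comment> \<open>The difference quotients of \<open>\<psi>\<close> integrate to 0 by translation invariance.\<close>
  define h :: "nat \<Rightarrow> real" where "h m = inverse (real (Suc m))" for m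
  have h: "h m > 0" "h m \<le> 1" for m by (auto simp: h_def field_simps)
  define q where "q m x = (\<psi> (x + h m *\<^sub>R v) - \<psi> x) / h m" for m x
  \<comment> \<open>The mean value theorem gives the bound \<open>B\<close>; the shifts have length
    at most 1, so all quotients vanish outside the ball of radius \<open>r + 1\<close>. This is the
    majorant for dominated convergence.\<close>
  have q_le: "\<bar>q m x\<bar> \<le> B * indicator (cball 0 (r + 1)) x" for m x
  proof -
    obtain s where "\<psi> (x + h m *\<^sub>R v) - \<psi> (x + 0 *\<^sub>R v) = (h m - 0) * g (x + s *\<^sub>R v)"
      using MVT2[OF h(1)[of m], of "\<lambda>s. \<psi> (x + s *\<^sub>R v)" "\<lambda>s. g (x + s *\<^sub>R v)"] deriv by blast
    then have "q m x = g (x + s *\<^sub>R v)" using h(1)[of m] by (simp add: q_def)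
    then have le: "\<bar>q m x\<bar> \<le> B" using gB by simp
    show ?thesis
    proof (cases "norm x \<le> r + 1")
      case True
      then show ?thesis using le by (simp add: indicator_def)
    next
      case False
      have "norm x \<le> norm (x + h m *\<^sub>R v) + norm (h m *\<^sub>R v)"
        using norm_triangle_ineq4[of "x + h m *\<^sub>R v" "h m *\<^sub>R v"] by simp
      also have "norm (h m *\<^sub>R v) \<le> 1" using h[of m] by (simp add: v_def)
      finally have "x + h m *\<^sub>R v \<notin> K" "x \<notin> K" using False r[of x] r[of "x + h m *\<^sub>R v"] by auto
      then show ?thesis using \<psi>0 B(1) by (simp add: q_def)
    qed
  qed
  have q_lim: "(\<lambda>m. q m x) \<longlonglongrightarrow> g x" for x
  proof -
    have "((\<lambda>s. (\<psi> (x + (0 + s) *\<^sub>R v) - \<psi> (x + 0 *\<^sub>R v)) / s) \<longlongrightarrow> g (x + 0 *\<^sub>R v)) (at 0)"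
      using deriv[of x 0] unfolding DERIV_def .
    moreover have "filterlim h (at 0) sequentially"
      unfolding filterlim_at using h LIMSEQ_inverse_real_of_nat
      by (auto simp: h_def[abs_def] intro!: always_eventually)
    ultimately show ?thesis
      using filterlim_compose[of _ "nhds (g x)" "at 0" h sequentially] by (simp add: q_def)
  qed
  have int_\<psi>: "integrable lborel \<psi>"
  proof -
    have "integrable lborel (\<lambda>x. indicator K x *\<^sub>R \<psi> x)"
      using borel_integrable_compact[OF K(1)] cont_\<psi> continuous_on_subset by blast
    moreover have "(\<lambda>x. indicator K x *\<^sub>R \<psi> x) = \<psi>"
      by (intro ext) (use \<psi>0 in \<open>auto simp: indicator_def\<close>)
    ultimately show ?thesis by simp
  qed
  have meas: "\<psi> \<in> borel_measurable borel" "g \<in> borel_measurable borel"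
    using cont_\<psi> cont_g by (auto intro: borel_measurable_continuous_onI)
  have shift: "integrable lborel (\<lambda>x. \<psi> (x + c)) \<and> (\<integral>x. \<psi> (x + c) \<partial>lborel) = (\<integral>x. \<psi> x \<partial>lborel)" for c
  proof -
    have "integrable (distr lborel borel ((+) c)) \<psi>" using int_\<psi> lborel_distr_plus[of c] by simp
    then have "integrable lborel (\<lambda>x. \<psi> (c + x))"
      by (subst (asm) integrable_distr_eq) (use meas in auto)
    moreover have "(\<integral>x. \<psi> x \<partial>(distr lborel borel ((+) c))) = (\<integral>x. \<psi> (c + x) \<partial>lborel)"
      by (rule integral_distr) (use meas in auto)
    ultimately show ?thesis using lborel_distr_plus[of c] by (simp add: add.commute)
  qed
  have int_q: "(\<integral>x. q m x \<partial>lborel) = 0" for m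
    unfolding q_def using shift[of "h m *\<^sub>R v"] int_\<psi> by simp
  have "(\<lambda>m. \<integral>x. q m x \<partial>lborel) \<longlonglongrightarrow> (\<integral>x. g x \<partial>lborel)"
  proof (rule integral_dominated_convergence[where w = "\<lambda>x. B * indicator (cball 0 (r + 1)) x"])
    show "integrable lborel (\<lambda>x::real^'d. B * indicator (cball 0 (r + 1)) x)"
      by (intro integrable_mult_right integrable_real_indicator) (auto intro: emeasure_bounded_finite[OF bounded_cball, unfolded infinity_ennreal_def])
    show "q m \<in> borel_measurable lborel" for m
      unfolding q_def using meas(1) by measurable
  qed (use meas q_lim q_le in auto)
  then have zero: "(\<integral>x. g x \<partial>lborel) = 0" by (simp add: int_q LIMSEQ_const_iff)
  have "(\<integral>x. g x \<partial>lebesgue_on \<Omega>) = (\<integral>x. indicator \<Omega> x *\<^sub>R g x \<partial>lebesgue)"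
    using \<Omega> by (intro integral_restrict_space) auto
  also have "\<dots> = (\<integral>x. g x \<partial>lebesgue)"
    using g0 K(2) by (intro Bochner_Integration.integral_cong) (auto simp: indicator_def)
  also have "\<dots> = (\<integral>x. g x \<partial>lborel)" using meas(2) by (intro integral_completion) simp
  finally show ?thesis using zero by (simp add: g_def)
qed

context mesh
begin

text \<open>\<open>discrete_poincare\<close> needs a vertex where the potential is prescribed. The
  Poincare inequality enters here to supply one.\<close>

lemma dirichlet_vertices_nonempty:
  assumes ne: "\<Omega> \<noteq> {}" and poincare: "poincare_inequality \<Omega> \<Gamma>"
    and sub: "P1_space_D \<Omega> \<T> \<Gamma> \<subseteq> H1_D \<Omega> \<Gamma>"
  shows "M \<inter> \<Gamma> \<noteq> {}"
proof
  assume empty: "M \<inter> \<Gamma> = {}"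
  \<comment> \<open>Then constants satisfy the discrete boundary condition, against the Poincare inequality.\<close>
  define v :: "real^'d \<Rightarrow> real" where "v = indicator (closure \<Omega>)"
  have v1: "v x = 1" if "x \<in> closure \<Omega>" for x using that by (simp add: v_def)
  have "continuous_on (closure \<Omega>) v"
    using continuous_on_const[of "closure \<Omega>" "1::real"] by (rule continuous_on_eq) (simp add: v1)
  moreover have "\<forall>x\<in>S. v x = 0 \<bullet> x + 1" if "S \<in> \<T>" for S
    using that closure_domain closure_subset[of S] by (auto intro!: v1)
  ultimately have "v \<in> P1_space \<Omega> \<T>"
    unfolding P1_space_def by (auto simp: v_def simp del: inner_zero_left)
  then have v: "v \<in> H1_D \<Omega> \<Gamma>" using sub empty by (auto simp: P1_space_D_def)
  have "weak_gradient \<Omega> v (\<lambda>_. 0)"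
    unfolding weak_gradient_def
  proof (intro conjI allI impI)
    show "(\<lambda>_. 0) \<in> L2 (lebesgue_on \<Omega>)" by (simp add: L2_def)
    fix \<psi> i assume "test_function \<Omega> \<psi>"
    moreover have "(\<integral>x. v x * grad \<psi> x $ i \<partial>lebesgue_on \<Omega>) = (\<integral>x. grad \<psi> x $ i \<partial>lebesgue_on \<Omega>)"
      using closure_subset[of \<Omega>] by (intro Bochner_Integration.integral_cong) (auto simp: v1 subsetD)
    ultimately show "(\<integral>x. v x * grad \<psi> x $ i \<partial>lebesgue_on \<Omega>) = - (\<integral>x. 0 $ i * \<psi> x \<partial>lebesgue_on \<Omega>)"
      using integral_grad_test_function open_domain by simp
  qed
  then obtain C where "L2_norm (lebesgue_on \<Omega>) v \<le> C * L2_norm (lebesgue_on \<Omega>) (\<lambda>_. 0 :: real^'d)"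
    using poincare v unfolding poincare_inequality_def by blast
  then have "L2_norm (lebesgue_on \<Omega>) v \<le> 0" by (simp add: L2_norm_def)
  moreover have "L2_norm (lebesgue_on \<Omega>) v = sqrt (measure lebesgue \<Omega>)"
  proof -
    have "(\<integral>x. (norm (v x))\<^sup>2 \<partial>lebesgue_on \<Omega>) = (\<integral>x. 1 \<partial>lebesgue_on \<Omega>)"
      using closure_subset[of \<Omega>] by (intro Bochner_Integration.integral_cong) (auto simp: v1 subsetD)
    then show ?thesis using open_domain
      by (simp add: L2_norm_def measure_restrict_space space_restrict_space)
  qed
  moreover have "measure lebesgue \<Omega> > 0"
    using open_not_negligible[OF open_domain ne] open_domain bounded_domain
      negligible_iff_measure0[OF lmeasurable_open[OF bounded_domain open_domain]]
    by (simp add: order.strict_iff_order)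
  ultimately show False by simp
qed

text \<open>The dual cells partition \<open>\<Omega>\<close> up to a null set, so the masses of the
  initial data pass unchanged to the discrete level.\<close>

lemma sum_integral_dual_cells:
  fixes u :: "real^'d \<Rightarrow> real"
  assumes u: "integrable (lebesgue_on \<Omega>) u"
  shows "(\<Sum>K\<in>M. \<integral>x. u x \<partial>lebesgue_on (dual_cell \<Omega> \<T> K)) = (\<integral>x. u x \<partial>lebesgue_on \<Omega>)"
proof -
  let ?d = "\<lambda>K. dual_cell \<Omega> \<T> K"
  have \<Omega>: "\<Omega> \<in> sets lebesgue" using open_domain by auto
  have d: "?d K \<in> sets lebesgue" if "K \<in> M" for K using dual_cell_lmeasurable[OF that] by auto
  have uO: "set_integrable lebesgue \<Omega> u"
    using u \<Omega> by (simp add: integrable_restrict_space set_integrable_def)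
  have "(\<Sum>K\<in>M. \<integral>x. u x \<partial>lebesgue_on (?d K)) = (\<Sum>K\<in>M. LINT x:?d K|lebesgue. u x)"
    by (intro sum.cong refl) (simp add: integral_restrict_space d set_lebesgue_integral_def)
  also have "\<dots> = (LINT x:(\<Union>K\<in>M. ?d K)|lebesgue. u x)"
  proof (rule set_integral_finite_Union[symmetric])
    show "disjoint_family_on ?d M" using disjoint_dual_cells by (auto simp: disjoint_family_on_def)
    show "set_integrable lebesgue (?d K) u" if "K \<in> M" for K
      by (rule set_integrable_subset[OF uO d[OF that]]) (auto simp: dual_cell_def)
  qed (auto simp: finite_mesh_vertices d)
  also have "\<dots> = (LINT x:\<Omega>|lebesgue. u x)"
  proof (rule set_integral_cong_set)
    have un: "(\<Union>K\<in>M. ?d K) \<in> sets lebesgue" using finite_mesh_vertices d by auto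
    show "set_borel_measurable lebesgue (\<Union>K\<in>M. ?d K) u"
      by (rule set_borel_measurable_subset[OF _ un])
        (use uO \<Omega> in \<open>auto simp: set_integrable_def set_borel_measurable_def dual_cell_def\<close>)
    show "set_borel_measurable lebesgue \<Omega> u" using uO by (auto simp: set_integrable_def set_borel_measurable_def)
    have "\<Omega> - (\<Union>K\<in>M. ?d K) \<in> null_sets lebesgue"
      using dual_cells_cover by (simp add: negligible_iff_null_sets)
    then show "AE x in lebesgue. (x \<in> \<Omega>) = (x \<in> (\<Union>K\<in>M. ?d K))"
      by (rule AE_I') (auto simp: dual_cell_def)
  qed
  also have "\<dots> = (\<integral>x. u x \<partial>lebesgue_on \<Omega>)"
    by (simp add: integral_restrict_space \<Omega> set_lebesgue_integral_def)
  finally show ?thesis .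
qed

lemma Linfty_integrable:
  assumes "u \<in> Linfty (lebesgue_on \<Omega>)"
  shows "integrable (lebesgue_on \<Omega>) u"
proof -
  obtain C where C: "AE x in lebesgue_on \<Omega>. \<bar>u x\<bar> \<le> C" "u \<in> borel_measurable (lebesgue_on \<Omega>)"
    using assms by (auto simp: Linfty_def)
  interpret finite_measure "lebesgue_on \<Omega>"
    using finite_measure_lebesgue_on[OF lmeasurable_open[OF bounded_domain open_domain]] .
  show ?thesis by (rule integrable_const_bound[where B=C]) (use C in auto)
qed

lemma integrable_dual_cell:
  fixes u :: "real^'d \<Rightarrow> real"
  assumes "integrable (lebesgue_on \<Omega>) u" "K \<in> M"
  shows "integrable (lebesgue_on (dual_cell \<Omega> \<T> K)) u"
proof -
  have "set_integrable lebesgue \<Omega> u"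
    using assms open_domain by (simp add: integrable_restrict_space set_integrable_def)
  then have "set_integrable lebesgue (dual_cell \<Omega> \<T> K) u"
    by (rule set_integrable_subset) (use dual_cell_lmeasurable[OF assms(2)] in \<open>auto simp: dual_cell_def\<close>)
  then show ?thesis
    using dual_cell_lmeasurable[OF assms(2)] by (simp add: integrable_restrict_space set_integrable_def)
qed

lemma AE_dual_cell:
  assumes "AE x in lebesgue_on \<Omega>. Q x" "K \<in> M"
  shows "AE x in lebesgue_on (dual_cell \<Omega> \<T> K). Q x"
proof -
  have "AE x in lebesgue. x \<in> \<Omega> \<longrightarrow> Q x"
    using assms(1) open_domain by (simp add: AE_restrict_space_iff)
  then have "AE x in lebesgue. x \<in> dual_cell \<Omega> \<T> K \<longrightarrow> Q x"
    by eventually_elim (auto simp: dual_cell_def)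
  then show ?thesis
    using dual_cell_lmeasurable[OF assms(2)] by (simp add: AE_restrict_space_iff fmeasurableD)
qed

end

section \<open>Cell mobilities: continuity and lower bound\<close>

lemma continuous_on_Max_image:
  fixes f :: "'a::topological_space \<Rightarrow> 'b \<Rightarrow> real"
  assumes "finite A" "A \<noteq> {}" "\<And>a. a \<in> A \<Longrightarrow> continuous_on X (\<lambda>x. f x a)"
  shows "continuous_on X (\<lambda>x. Max (f x ` A))"
  using assms
proof (induction A rule: finite_ne_induct)
  case (insert a A)
  then have "(\<lambda>x. Max (f x ` insert a A)) = (\<lambda>x. max (f x a) (Max (f x ` A)))" by simp
  then show ?case using insert by (auto intro!: continuous_on_max)
qed simp

lemma continuous_on_cell_value:
  fixes S :: "(real^'d) set"
  assumes "finite (vertices S)" "vertices S \<noteq> {}" "\<And>K. K \<in> vertices S \<Longrightarrow> continuous_on X (\<lambda>x. w x K)"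
  shows "continuous_on X (\<lambda>x. cell_value mob (w x) S)"
  using assms by (cases mob) (auto intro!: continuous_on_Max_image continuous_intros)

lemma cell_value_ge:
  fixes S :: "(real^'d) set"
  assumes "finite (vertices S)" "K \<in> vertices S" "\<And>L. L \<in> vertices S \<Longrightarrow> w L \<ge> 0"
  shows "1 / (real CARD('d) + 1) * w K \<le> cell_value mob w S"
proof (cases mob)
  case Maximum
  have "1 / (real CARD('d) + 1) * w K \<le> 1 * w K"
    using assms by (intro mult_right_mono) (auto simp: field_simps)
  also have "w K \<le> Max (w ` vertices S)" using assms by (intro Max_ge) auto
  finally show ?thesis using Maximum by simp
next
  case Average
  have "w K \<le> (\<Sum>L\<in>vertices S. w L)" using assms by (intro member_le_sum) auto
  then show ?thesis using Average by (simp add: divide_right_mono)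
qed

section \<open>The scheme on a simplicial mesh\<close>

lemma (in mesh) cell_complex_mobility:
  assumes "connected \<Omega>"
  shows "cell_complex_mobility M \<T> vertices (\<lambda>S K. cell_grad (nodal_basis \<Omega> \<T> K) S) (measure lebesgue)
    (diameter (closure \<Omega>) + 1) (cell_value mob) (1 / (real CARD('d) + 1))"
proof
  show "finite M" "finite \<T>" by (rule finite_mesh_vertices finite_cells)+
  show "0 < diameter (closure \<Omega>) + 1"
    using diameter_ge_0[of "closure \<Omega>"] bounded_domain by (simp add: bounded_closure)
  show "0 < 1 / (real CARD('d) + 1)" by simp
next
  fix S assume S: "S \<in> \<T>"
  show "vertices S \<subseteq> M" using S by (auto simp: mesh_vertices_def)
  have "S \<subseteq> closure \<Omega>" using S closure_subset[of S] closure_domain by blast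
  then have "S \<in> lmeasurable"
    using simplexD(6)[OF S] bounded_domain bounded_subset by (blast intro: lmeasurable_open bounded_closure)
  then show "0 < measure lebesgue S"
    using open_not_negligible[OF simplexD(6,7)[OF S]] negligible_iff_measure0
    by (auto simp: order.strict_iff_order)
  have "\<exists>x. x \<in> closure S" using simplexD(7)[OF S] closure_subset by blast
  then show "(\<Sum>L\<in>vertices S. cell_grad (nodal_basis \<Omega> \<T> L) S) = 0"
    using nodal_basis_partition_of_unity(3)[OF S] by blast
next
  fix S K L and v :: "real^'d \<Rightarrow> real"
  assume "S \<in> \<T>" "K \<in> vertices S" "L \<in> vertices S"
  then show "\<bar>v K - v L\<bar> \<le> (diameter (closure \<Omega>) + 1) *
      norm (\<Sum>J\<in>vertices S. v J *\<^sub>R cell_grad (nodal_basis \<Omega> \<T> J) S)"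
    by (rule nodal_diff_le)
next
  fix R assume "R \<subseteq> M" "R \<noteq> {}" "\<And>S. S \<in> \<T> \<Longrightarrow> vertices S \<inter> R \<noteq> {} \<Longrightarrow> vertices S \<subseteq> R"
  then show "R = M" by (rule mesh_connected[OF assms])
next
  fix S K and w :: "real^'d \<Rightarrow> real"
  assume "S \<in> \<T>" "K \<in> vertices S" "\<And>L. L \<in> vertices S \<Longrightarrow> 0 \<le> w L"
  then show "1 / (real CARD('d) + 1) * w K \<le> cell_value mob w S"
    using simplexD(2) by (intro cell_value_ge)
next
  fix S and f :: "(nat \<times> (real^'d) \<Rightarrow> real) \<Rightarrow> real^'d \<Rightarrow> real"
  assume S: "S \<in> \<T>" and f: "\<And>K. K \<in> vertices S \<Longrightarrow> continuous_on UNIV (\<lambda>x. f x K)"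
  have "vertices S \<noteq> {}" using simplexD(3)[OF S] by auto
  then show "continuous_on UNIV (\<lambda>x. cell_value mob (f x) S)"
    using f simplexD(2)[OF S] by (intro continuous_on_cell_value)
qed

section \<open>Admissible states and iteration in time\<close>

lemma concentration_Suc:
  "concentration \<Omega> \<T> n u_ini \<mu> (Suc k) i = softmax n (\<mu> (Suc k)) i"
  by (rule ext) (simp add: concentration_def softmax_def Let_def)

text \<open>The invariant handed from step to step. It asks for positive total masses, the solvent
  included, rather than positive values, because the initial data may vanish on whole dual
  cells.\<close>

definition admissible :: "'v set \<Rightarrow> ('v \<Rightarrow> real) \<Rightarrow> nat \<Rightarrow> (nat \<Rightarrow> 'v \<Rightarrow> real) \<Rightarrow> bool" where
  "admissible M m n v \<longleftrightarrow>
     (\<forall>i\<in>{1..n}. \<forall>K\<in>M. v i K \<ge> 0) \<and> (\<forall>K\<in>M. (\<Sum>i=1..n. v i K) \<le> 1) \<and>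
     (\<forall>i\<in>{1..n}. (\<Sum>K\<in>M. m K * v i K) > 0) \<and> (\<Sum>K\<in>M. m K * (1 - (\<Sum>i=1..n. v i K))) > 0"

lemma admissible_softmax:
  assumes "finite M" "M \<noteq> {}" "\<And>K. K \<in> M \<Longrightarrow> m K > 0"
  shows "admissible M m n (softmax n \<mu>)"
proof -
  have 1: "1 - (\<Sum>i=1..n. softmax n \<mu> i K) = softmax n \<mu> 0 K" for K
    using softmax_sum[of n \<mu> K] by linarith
  then have "(\<Sum>i=1..n. softmax n \<mu> i K) \<le> 1" for K
    using softmax_pos[of n \<mu> 0 K] by (metis diff_ge_0_iff_ge less_imp_le)
  then show ?thesis
    unfolding admissible_def 1 using assms
    by (auto intro!: sum_pos mult_pos_pos softmax_pos less_imp_le[OF softmax_pos])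
qed

lemma (in mesh) admissible_initial:
  fixes u_ini :: "nat \<Rightarrow> real^'d \<Rightarrow> real"
  defines "m \<equiv> \<lambda>K. measure lebesgue (dual_cell \<Omega> \<T> K)"
  assumes Linf: "\<And>i. i \<in> {0..n} \<Longrightarrow> u_ini i \<in> Linfty (lebesgue_on \<Omega>)"
    and nonneg: "\<And>i. i \<in> {0..n} \<Longrightarrow> AE x in lebesgue_on \<Omega>. u_ini i x \<ge> 0"
    and sum1: "AE x in lebesgue_on \<Omega>. (\<Sum>i=0..n. u_ini i x) = 1"
    and mass: "\<And>i. i \<in> {0..n} \<Longrightarrow> (\<integral>x. u_ini i x \<partial>lebesgue_on \<Omega>) > 0"
  shows "admissible M m n (concentration \<Omega> \<T> n u_ini \<mu> 0)"
proof -
  define I where "I i K = (\<integral>x. u_ini i x \<partial>lebesgue_on (dual_cell \<Omega> \<T> K))" for i K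
  define v where "v = concentration \<Omega> \<T> n u_ini \<mu> 0"
  have m: "m K > 0" if "K \<in> M" for K using dual_cell_measure_pos[OF that] by (simp add: m_def)
  have v: "v i K = I i K / m K" for i K by (simp add: v_def concentration_def I_def m_def)
  have I0: "I i K \<ge> 0" if "i \<in> {0..n}" "K \<in> M" for i K
    unfolding I_def using AE_dual_cell[OF nonneg[OF that(1)] that(2)] by (rule integral_nonneg_AE)
  have Isum: "(\<Sum>i=0..n. I i K) = m K" if K: "K \<in> M" for K
  proof -
    have int: "integrable (lebesgue_on (dual_cell \<Omega> \<T> K)) (u_ini i)" if "i \<in> {0..n}" for i
      using Linf[OF that] K by (intro integrable_dual_cell Linfty_integrable)
    then have "(\<Sum>i=0..n. I i K) = (\<integral>x. (\<Sum>i=0..n. u_ini i x) \<partial>lebesgue_on (dual_cell \<Omega> \<T> K))"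
      unfolding I_def by (intro Bochner_Integration.integral_sum[symmetric]) auto
    also have "\<dots> = (\<integral>x. 1 \<partial>lebesgue_on (dual_cell \<Omega> \<T> K))"
      using AE_dual_cell[OF sum1 K] int
      by (intro integral_cong_AE) (auto intro!: borel_measurable_sum borel_measurable_integrable)
    also have "\<dots> = m K"
      using dual_cell_lmeasurable[OF K] by (simp add: m_def measure_restrict_space fmeasurableD)
    finally show ?thesis .
  qed
  then have I0n: "I 0 K + (\<Sum>i=1..n. I i K) = m K" if "K \<in> M" for K
    using that by (simp add: sum.atLeast_Suc_atMost)
  have 1: "(\<Sum>i=1..n. v i K) = 1 - I 0 K / m K" if "K \<in> M" for K
  proof -
    have "(\<Sum>i=1..n. v i K) = (m K - I 0 K) / m K"
      using I0n[OF that] by (simp add: v sum_divide_distrib[symmetric] algebra_simps)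
    then show ?thesis using m[OF that] by (simp add: diff_divide_distrib)
  qed
  have total: "(\<Sum>K\<in>M. I i K) > 0" if "i \<in> {0..n}" for i
    unfolding I_def using sum_integral_dual_cells[OF Linfty_integrable[OF Linf[OF that]]] mass[OF that] by simp
  show ?thesis
    unfolding admissible_def v_def[symmetric]
  proof (intro conjI ballI)
    fix i K assume "i \<in> {1..n}" "K \<in> M"
    then show "v i K \<ge> 0" using I0[of i K] m[of K] by (simp add: v)
  next
    fix K assume "K \<in> M"
    then show "(\<Sum>i=1..n. v i K) \<le> 1" using 1 I0[of 0 K] m[of K] by simp
  next
    fix i assume i: "i \<in> {1..n}"
    have "(\<Sum>K\<in>M. m K * v i K) = (\<Sum>K\<in>M. I i K)"
      using m by (intro sum.cong) (auto simp: v less_imp_neq[symmetric])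
    then show "(\<Sum>K\<in>M. m K * v i K) > 0" using total[of i] i by simp
  next
    have "(\<Sum>K\<in>M. m K * (1 - (\<Sum>i=1..n. v i K))) = (\<Sum>K\<in>M. I 0 K)"
      using m by (intro sum.cong) (auto simp: 1 less_imp_neq[symmetric] simp del: One_nat_def)
    then show "(\<Sum>K\<in>M. m K * (1 - (\<Sum>i=1..n. v i K))) > 0" using total[of 0] by simp
  qed
qed

theorem theorem2p1:
  fixes \<Omega> \<Gamma>\<^sub>D \<Gamma>\<^sub>N :: "(real^'d) set"
    and T lam \<beta> :: real
    and n N :: nat
    and z D :: "nat \<Rightarrow> real"
    and u_ini :: "nat \<Rightarrow> real^'d \<Rightarrow> real"
    and \<phi>\<^sub>D \<phi>\<^sub>D\<^sub>T f :: "real^'d \<Rightarrow> real"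
    and \<T> :: "(real^'d) set set"
    and t :: "nat \<Rightarrow> real"
    and mob :: mobility
  assumes "CARD('d) \<in> {2, 3}"
    and "open \<Omega>" "bounded \<Omega>" "connected \<Omega>" "polytopal \<Omega>" "lipschitz_boundary \<Omega>"
    and "regular_partition \<Omega> \<Gamma>\<^sub>D \<Gamma>\<^sub>N"
    and "T > 0" "lam > 0" "\<beta> > 0" "n \<ge> 1"
    and "\<And>i. i \<in> {1..n} \<Longrightarrow> D i > 0"
    and "\<And>i. i \<in> {0..n} \<Longrightarrow> u_ini i \<in> Linfty (lebesgue_on \<Omega>)"
    and "\<And>i. i \<in> {0..n} \<Longrightarrow> AE x in lebesgue_on \<Omega>. u_ini i x \<ge> 0"
    and "AE x in lebesgue_on \<Omega>. (\<Sum>i=0..n. u_ini i x) = 1"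
    and "\<And>i. i \<in> {0..n} \<Longrightarrow> (\<integral>x. u_ini i x \<partial>lebesgue_on \<Omega>) > 0"
    and "\<phi>\<^sub>D \<in> H1 \<Omega>"
    and "f \<in> L2 (lebesgue_on \<Omega>)"
    and "poincare_inequality \<Omega> \<Gamma>\<^sub>D"
    and "simplicial_mesh \<Omega> \<T>"
    and "P1_space_D \<Omega> \<T> \<Gamma>\<^sub>D \<subseteq> H1_D \<Omega> \<Gamma>\<^sub>D"
    and "\<phi>\<^sub>D\<^sub>T \<in> P1_space \<Omega> \<T>"
    and "time_sequence T N t"
  shows "\<exists>\<mu> \<phi>. cvfe_solution \<Omega> \<Gamma>\<^sub>D \<T> n z D lam \<beta> u_ini f \<phi>\<^sub>D\<^sub>T N t mob \<mu> \<phi>"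
proof -
  interpret mesh \<Omega> \<T> using assms(2,3,20) by unfold_locales
  interpret cell_complex_mobility M \<T> vertices "\<lambda>S K. cell_grad (nodal_basis \<Omega> \<T> K) S"
    "measure lebesgue" "diameter (closure \<Omega>) + 1" "cell_value mob" "1 / (real CARD('d) + 1)"
    by (rule cell_complex_mobility[OF assms(4)])
  define m where "m = (\<lambda>K. measure lebesgue (dual_cell \<Omega> \<T> K))"
  define g where "g = (\<lambda>K. \<integral>x. f x \<partial>lebesgue_on (dual_cell \<Omega> \<T> K))"
  have m: "m K > 0" if "K \<in> M" for K using dual_cell_measure_pos[OF that] by (simp add: m_def)
  \<comment> \<open>The solvent has positive initial mass, which excludes an empty domain.\<close>
  have "\<Omega> \<noteq> {}" using assms(16)[of 0] by (auto simp: integral_restrict_space set_lebesgue_integral_def)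
  then have MD: "M \<inter> \<Gamma>\<^sub>D \<noteq> {}" using assms(19,21) by (rule dirichlet_vertices_nonempty)
  define step where "step \<tau> v \<mu> \<phi> \<longleftrightarrow>
      (\<forall>i\<in>{1..n}. \<forall>K\<in>M. m K * ((softmax n \<mu> i K - v i K) / \<tau>) +
         (\<Sum>S\<in>star K. \<Sum>L\<in>vertices S. cell_value mob (softmax n \<mu> 0) S * cell_value mob (softmax n \<mu> i) S *
            (D i * stiff S K L * ((\<mu> i K - \<mu> i L) + \<beta> * z i * (\<phi> K - \<phi> L)))) = 0) \<and>
      (\<forall>K\<in>M \<inter> \<Gamma>\<^sub>D. \<phi> K = \<phi>\<^sub>D\<^sub>T K) \<and>
      (\<forall>K\<in>M - \<Gamma>\<^sub>D. lam\<^sup>2 * (\<Sum>S\<in>star K. \<Sum>L\<in>vertices S. stiff S K L * (\<phi> K - \<phi> L)) =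
         m K * (\<Sum>i=1..n. z i * softmax n \<mu> i K) + g K)" for \<tau> v \<mu> \<phi>
  have step_ex: "\<exists>\<mu> \<phi>. step \<tau> v \<mu> \<phi>" if \<tau>: "\<tau> > 0" and v: "admissible M m n v" for \<tau> v
  proof -
    obtain \<mu> \<phi> where
      "\<And>i K. i \<in> {1..n} \<Longrightarrow> K \<in> M \<Longrightarrow> m K * ((softmax n \<mu> i K - v i K) / \<tau>) +
         (\<Sum>S\<in>star K. \<Sum>L\<in>vertices S. cell_value mob (softmax n \<mu> 0) S * cell_value mob (softmax n \<mu> i) S *
            (D i * stiff S K L * ((\<mu> i K - \<mu> i L) + \<beta> * z i * (\<phi> K - \<phi> L)))) = 0"
      "\<And>K. K \<in> M \<inter> \<Gamma>\<^sub>D \<Longrightarrow> \<phi> K = \<phi>\<^sub>D\<^sub>T K"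
      "\<And>K. K \<in> M - M \<inter> \<Gamma>\<^sub>D \<Longrightarrow> lam\<^sup>2 * (\<Sum>S\<in>star K. \<Sum>L\<in>vertices S. stiff S K L * (\<phi> K - \<phi> L)) =
         m K * (\<Sum>i=1..n. z i * softmax n \<mu> i K) + g K"
      by (rule time_step_solution[of "M \<inter> \<Gamma>\<^sub>D" "lam\<^sup>2" \<tau> n D m v \<beta> z \<phi>\<^sub>D\<^sub>T g])
        (use MD assms(9,12) \<tau> v m in \<open>auto simp: admissible_def\<close>)
    then have "step \<tau> v \<mu> \<phi>" unfolding step_def by (intro conjI ballI) blast+
    then show ?thesis by blast
  qed
  have \<tau>: "t (Suc k) - t k > 0" if "k < N" for k
    using assms(23) that by (simp add: time_sequence_def)
  \<comment> \<open>Level 0 is computed from \<open>u_ini\<close> alone; the zero potentials are a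
    placeholder until \<open>\<mu>\<close> is constructed.\<close>
  define v0 where "v0 = concentration \<Omega> \<T> n u_ini (\<lambda>_ _ _. 0) 0"
  have v0: "admissible M m n v0"
    unfolding v0_def m_def using assms(13-16) by (rule admissible_initial)
  have "M \<noteq> {}" using MD by blast
  then have adm: "admissible M m n (softmax n \<mu>)" for \<mu>
    by (intro admissible_softmax finite_mesh_vertices m)
  \<comment> \<open>The recursion is total: from level \<open>N\<close> on the choice may be
    arbitrary, but the softmax of any potentials is admissible, so the states are admissible at
    every level.\<close>
  define next_state where "next_state k s = (SOME p. step (t (Suc k) - t k) s (fst p) (snd p))" for k s
  define state where "state = rec_nat v0 (\<lambda>k s. softmax n (fst (next_state k s)))"
  \<comment> \<open>Truncated subtraction makes level 0 a copy of level 1; the scheme reads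
    potentials from level 1 on.\<close>
  define \<mu> where "\<mu> k = fst (next_state (k - 1) (state (k - 1)))" for k
  define \<phi> where "\<phi> k = snd (next_state (k - 1) (state (k - 1)))" for k
  have state_0: "state 0 = v0" and state_Suc: "state (Suc k) = softmax n (\<mu> (Suc k))" for k
    by (simp_all add: state_def \<mu>_def)
  have "admissible M m n (state k)" for k
    by (cases k) (simp_all add: state_0 state_Suc v0 adm)
  then have step: "step (t (Suc k) - t k) (state k) (\<mu> (Suc k)) (\<phi> (Suc k))" if "k < N" for k
    unfolding \<mu>_def \<phi>_def next_state_def
    using someI_ex[of "\<lambda>p. step (t (Suc k) - t k) (state k) (fst p) (snd p)"] step_ex[OF \<tau>[OF that]]
    by (metis diff_Suc_1 fst_conv snd_conv)
  have conc: "concentration \<Omega> \<T> n u_ini \<mu> k = state k" for k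
  proof (cases k)
    case 0
    then show ?thesis by (auto simp: state_0 v0_def concentration_def fun_eq_iff)
  next
    case (Suc k')
    then show ?thesis by (auto simp: state_Suc concentration_Suc)
  qed
  have stiff: "stiff = stiffness \<Omega> \<T>" by (auto simp: fun_eq_iff stiff_def stiffness_def)
  have star: "star = patch \<T>" by (auto simp: fun_eq_iff star_def patch_def)
  have "cvfe_solution \<Omega> \<Gamma>\<^sub>D \<T> n z D lam \<beta> u_ini f \<phi>\<^sub>D\<^sub>T N t mob \<mu> \<phi>"
    unfolding cvfe_solution_def Let_def conc
  proof (rule ballI)
    fix k assume "k \<in> {1..N}"
    then obtain k' where k: "k = Suc k'" "k' < N" by (cases k) auto
    show "(\<forall>i\<in>{1..n}. \<forall>K\<in>M. measure lebesgue (dual_cell \<Omega> \<T> K) * ((state k i K - state (k - 1) i K) / (t k - t (k - 1))) +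
           (\<Sum>S\<in>patch \<T> K. \<Sum>L\<in>vertices S. cell_value mob (state k 0) S * cell_value mob (state k i) S *
              flux \<Omega> \<T> D z \<beta> \<mu> \<phi> k S i K L) = 0) \<and>
        (\<forall>K \<in> M \<inter> \<Gamma>\<^sub>D. \<phi> k K = \<phi>\<^sub>D\<^sub>T K) \<and>
        (\<forall>K \<in> M - \<Gamma>\<^sub>D. lam\<^sup>2 * (\<Sum>S\<in>patch \<T> K. \<Sum>L\<in>vertices S. stiffness \<Omega> \<T> S K L * (\<phi> k K - \<phi> k L)) =
           measure lebesgue (dual_cell \<Omega> \<T> K) * (\<Sum>i=1..n. z i * state k i K) +
           (\<integral>x. f x \<partial>lebesgue_on (dual_cell \<Omega> \<T> K)))"
      using step[OF k(2)] unfolding k(1) step_def stiff star flux_def state_Suc m_def g_def diff_Suc_1 .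
  qed
  then show ?thesis by blast
qed

end
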